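(* Under the standing assumptions and notation below, if $A^{1/2}W_2^2\subset W_2^2$, then the minimal operator $L_0$ is formally normal in $L^2$.
   Context: Let $(a_n),(b_n)$ be real sequences with $-\infty<a_n<b_n\le a_{n+1}<\infty$, $\Delta_n=(a_n,b_n)$. For each $n\ge1$, $H_n$ is a Hilbert space and $A_n$ a positive definite selfadjoint operator in $H_n$. $L_n^2=L^2(H_n,\Delta_n)$, $L^2=\bigoplus_n L^2_n$ (Hilbert direct sum). $l_n(u_n)=-u_n''+iA_nu_n$. $L_{n0}$ is the closure in $L^2_n$ of $u_n\mapsto l_n(u_n)$ defined on finite sums $\sum_k\varphi_kf_k$, $\varphi_k\in C_0^\infty(\Delta_n)$, $f_k\in D(A_n)$, and $L_0=\bigoplus_nL_{n0}$ (domain: $u=(u_n)\in L^2$, $u_n\in D(L_{n0})$, $\sum_n\|L_{n0}u_n\|^2<\infty$). $W_2^2=\bigoplus_nW_2^2(H_n,\Delta_n)$ (sequences with $\sum_n\|u_n\|^2_{W_2^2(H_n,\Delta_n)}<\infty$, $W_2^2(H_n,\Delta_n)$ the $H_n$-valued Sobolev space of order 2). $A^{1/2}$ denotes the operator $(A^{1/2}u)_n(t)=A_n^{1/2}u_n(t)$; the hypothesis $A^{1/2}W_2^2\subset W_2^2$ means that for every $u\in W_2^2$, $u_n(t)\in D(A_n^{1/2})$ and $A^{1/2}u\in W_2^2$. An operator $T$ is formally normal if it is densely defined, $D(T)\subset D(T^* )$ and $\|Tu\|=\|T^*u\|$ for all $u\in D(T)$. *)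

theory Defs
  imports "HOL-Analysis.Analysis"
begin

text \<open>Complex Hilbert spaces are modelled as real Hilbert spaces (type class
  real_inner + complete_space) equipped with an orthogonal complex structure J
  (J = multiplication by the imaginary unit i). The real inner product is the real
  part of the complex one. The Hilbert spaces H_n are closed complex (J-invariant)
  subspaces of one ambient Hilbert space. Linear operators are represented by their
  graphs.\<close>

definition cstruct :: "('h::{real_inner,complete_space} \<Rightarrow> 'h) \<Rightarrow> bool" where
  "cstruct J \<longleftrightarrow> linear J \<and> (\<forall>x. J (J x) = - x) \<and> (\<forall>x y. inner (J x) (J y) = inner x y)"

definition csubspace :: "('h::{real_inner,complete_space} \<Rightarrow> 'h) \<Rightarrow> 'h set \<Rightarrow> bool" where
  "csubspace J H \<longleftrightarrow> subspace H \<and> closed H \<and> (\<forall>x\<in>H. J x \<in> H)"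

definition lin_op :: "('h::{real_inner,complete_space} \<Rightarrow> 'h) \<Rightarrow> 'h set \<Rightarrow> ('h \<times> 'h) set \<Rightarrow> bool" where
  "lin_op J H G \<longleftrightarrow> G \<subseteq> H \<times> H \<and> (0, 0) \<in> G
     \<and> (\<forall>x y x' y'. (x, y) \<in> G \<longrightarrow> (x', y') \<in> G \<longrightarrow> (x + x', y + y') \<in> G)
     \<and> (\<forall>c x y. (x, y) \<in> G \<longrightarrow> (c *\<^sub>R x, c *\<^sub>R y) \<in> G)
     \<and> (\<forall>x y. (x, y) \<in> G \<longrightarrow> (J x, J y) \<in> G)
     \<and> (\<forall>x y z. (x, y) \<in> G \<longrightarrow> (x, z) \<in> G \<longrightarrow> y = z)"

text \<open>Adjoint in H (for J-invariant graphs this coincides with the complex adjoint).\<close>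
definition op_adj :: "'h::{real_inner,complete_space} set \<Rightarrow> ('h \<times> 'h) set \<Rightarrow> ('h \<times> 'h) set" where
  "op_adj H G = {(v, w). v \<in> H \<and> w \<in> H \<and> (\<forall>(x, y)\<in>G. inner y v = inner x w)}"

definition selfadjoint_op :: "('h::{real_inner,complete_space} \<Rightarrow> 'h) \<Rightarrow> 'h set \<Rightarrow> ('h \<times> 'h) set \<Rightarrow> bool" where
  "selfadjoint_op J H G \<longleftrightarrow> lin_op J H G \<and> H \<subseteq> closure (Domain G) \<and> op_adj H G = G"

definition posdef_op :: "('h::{real_inner,complete_space} \<times> 'h) set \<Rightarrow> bool" where
  "posdef_op G \<longleftrightarrow> (\<exists>c>0. \<forall>(x, y)\<in>G. inner y x \<ge> c * (norm x)\<^sup>2)"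

definition sqrt_op :: "('h::{real_inner,complete_space} \<Rightarrow> 'h) \<Rightarrow> 'h set \<Rightarrow> ('h \<times> 'h) set \<Rightarrow> ('h \<times> 'h) set" where
  "sqrt_op J H G = (THE B. selfadjoint_op J H B \<and> (\<forall>(x, y)\<in>B. inner y x \<ge> 0) \<and> B O B = G)"

definition strongly_meas :: "real set \<Rightarrow> (real \<Rightarrow> 'h::{real_inner,complete_space}) \<Rightarrow> bool" where
  "strongly_meas S u \<longleftrightarrow> (\<exists>s :: nat \<Rightarrow> real \<Rightarrow> 'h.
      (\<forall>k. finite (range (s k)) \<and> s k \<in> borel_measurable lborel)
      \<and> (AE t in lebesgue. t \<in> S \<longrightarrow> (\<lambda>k. s k t) \<longlonglongrightarrow> u t))"

definition sqn :: "real set \<Rightarrow> (real \<Rightarrow> 'h::{real_inner,complete_space}) \<Rightarrow> ennreal" where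
  "sqn S u = (\<integral>\<^sup>+ t\<in>S. ennreal ((norm (u t))\<^sup>2) \<partial>lebesgue)"

definition memL2 :: "'h::{real_inner,complete_space} set \<Rightarrow> real set \<Rightarrow> (real \<Rightarrow> 'h) \<Rightarrow> bool" where
  "memL2 H S u \<longleftrightarrow> strongly_meas S u \<and> (AE t in lebesgue. t \<in> S \<longrightarrow> u t \<in> H) \<and> sqn S u < \<infinity>"

definition ipL2 :: "real set \<Rightarrow> (real \<Rightarrow> 'h::{real_inner,complete_space}) \<Rightarrow> (real \<Rightarrow> 'h) \<Rightarrow> real" where
  "ipL2 S u v = (LINT t:S|lebesgue. inner (u t) (v t))"

definition sqnS :: "(nat \<Rightarrow> real) \<Rightarrow> (nat \<Rightarrow> real) \<Rightarrow> (nat \<Rightarrow> real \<Rightarrow> 'h::{real_inner,complete_space}) \<Rightarrow> ennreal" where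
  "sqnS a b u = (\<Sum>n. sqn {a n<..<b n} (u n))"

definition memL2S :: "(nat \<Rightarrow> 'h::{real_inner,complete_space} set) \<Rightarrow> (nat \<Rightarrow> real) \<Rightarrow> (nat \<Rightarrow> real) \<Rightarrow> (nat \<Rightarrow> real \<Rightarrow> 'h) \<Rightarrow> bool" where
  "memL2S Hs a b u \<longleftrightarrow> (\<forall>n. memL2 (Hs n) {a n<..<b n} (u n)) \<and> sqnS a b u < \<infinity>"

definition ipL2S :: "(nat \<Rightarrow> real) \<Rightarrow> (nat \<Rightarrow> real) \<Rightarrow> (nat \<Rightarrow> real \<Rightarrow> 'h::{real_inner,complete_space}) \<Rightarrow> (nat \<Rightarrow> real \<Rightarrow> 'h) \<Rightarrow> real" where
  "ipL2S a b u v = (\<Sum>n. ipL2 {a n<..<b n} (u n) (v n))"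

definition testfun :: "real \<Rightarrow> real \<Rightarrow> (real \<Rightarrow> real) \<Rightarrow> bool" where
  "testfun a b \<phi> \<longleftrightarrow> (\<forall>k x. ((deriv ^^ k) \<phi>) differentiable (at x))
     \<and> (\<exists>c d. a < c \<and> c \<le> d \<and> d < b \<and> (\<forall>x. x \<notin> {c..d} \<longrightarrow> \<phi> x = 0))"

definition weak_deriv :: "real \<Rightarrow> real \<Rightarrow> (real \<Rightarrow> 'h::{real_inner,complete_space}) \<Rightarrow> (real \<Rightarrow> 'h) \<Rightarrow> bool" where
  "weak_deriv a b u g \<longleftrightarrow> (\<forall>\<phi> h. testfun a b \<phi> \<longrightarrow>
     (LINT t:{a<..<b}|lebesgue. deriv \<phi> t * inner (u t) h)
       = - (LINT t:{a<..<b}|lebesgue. \<phi> t * inner (g t) h))"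

definition memW22S :: "(nat \<Rightarrow> 'h::{real_inner,complete_space} set) \<Rightarrow> (nat \<Rightarrow> real) \<Rightarrow> (nat \<Rightarrow> real) \<Rightarrow> (nat \<Rightarrow> real \<Rightarrow> 'h) \<Rightarrow> bool" where
  "memW22S Hs a b u \<longleftrightarrow> memL2S Hs a b u \<and> (\<exists>g1 g2. memL2S Hs a b g1 \<and> memL2S Hs a b g2
     \<and> (\<forall>n. weak_deriv (a n) (b n) (u n) (g1 n) \<and> weak_deriv (a n) (b n) (g1 n) (g2 n)))"

text \<open>Graph of u \<mapsto> l(u) = -u'' + iAu on finite sums \<Sum> \<phi>_k f_k.\<close>
definition pre_min :: "('h::{real_inner,complete_space} \<Rightarrow> 'h) \<Rightarrow> ('h \<times> 'h) set \<Rightarrow> real \<Rightarrow> real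
     \<Rightarrow> ((real \<Rightarrow> 'h) \<times> (real \<Rightarrow> 'h)) set" where
  "pre_min J A a b = {(\<lambda>t. \<Sum>k<m. \<phi> k t *\<^sub>R f k,
        \<lambda>t. \<Sum>k<m. (- (deriv ^^ 2) (\<phi> k) t) *\<^sub>R f k + \<phi> k t *\<^sub>R J (g k)) | (m::nat) \<phi> f g.
      \<forall>k<m. testfun a b (\<phi> k :: real \<Rightarrow> real) \<and> (f k, g k) \<in> A}"

definition closureL2 :: "'h::{real_inner,complete_space} set \<Rightarrow> real \<Rightarrow> real
     \<Rightarrow> ((real \<Rightarrow> 'h) \<times> (real \<Rightarrow> 'h)) set \<Rightarrow> ((real \<Rightarrow> 'h) \<times> (real \<Rightarrow> 'h)) set" where
  "closureL2 H a b G = {(u, f). memL2 H {a<..<b} u \<and> memL2 H {a<..<b} f \<and>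
     (\<exists>us fs. (\<forall>k. (us k, fs k) \<in> G)
        \<and> (\<lambda>k. sqn {a<..<b} (\<lambda>t. us k t - u t)) \<longlonglongrightarrow> 0
        \<and> (\<lambda>k. sqn {a<..<b} (\<lambda>t. fs k t - f t)) \<longlonglongrightarrow> 0)}"

definition L0 :: "('h::{real_inner,complete_space} \<Rightarrow> 'h) \<Rightarrow> (nat \<Rightarrow> 'h set) \<Rightarrow> (nat \<Rightarrow> ('h \<times> 'h) set)
     \<Rightarrow> (nat \<Rightarrow> real) \<Rightarrow> (nat \<Rightarrow> real) \<Rightarrow> ((nat \<Rightarrow> real \<Rightarrow> 'h) \<times> (nat \<Rightarrow> real \<Rightarrow> 'h)) set" where
  "L0 J Hs A a b = {(u, f). memL2S Hs a b u \<and> memL2S Hs a b f \<and>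
     (\<forall>n. (u n, f n) \<in> closureL2 (Hs n) (a n) (b n) (pre_min J (A n) (a n) (b n)))}"

definition adjL2S :: "(nat \<Rightarrow> 'h::{real_inner,complete_space} set) \<Rightarrow> (nat \<Rightarrow> real) \<Rightarrow> (nat \<Rightarrow> real)
     \<Rightarrow> ((nat \<Rightarrow> real \<Rightarrow> 'h) \<times> (nat \<Rightarrow> real \<Rightarrow> 'h)) set \<Rightarrow> ((nat \<Rightarrow> real \<Rightarrow> 'h) \<times> (nat \<Rightarrow> real \<Rightarrow> 'h)) set" where
  "adjL2S Hs a b T = {(v, w). memL2S Hs a b v \<and> memL2S Hs a b w \<and>
     (\<forall>(u, f)\<in>T. ipL2S a b f v = ipL2S a b u w)}"

definition formally_normal :: "(nat \<Rightarrow> 'h::{real_inner,complete_space} set) \<Rightarrow> (nat \<Rightarrow> real) \<Rightarrow> (nat \<Rightarrow> real)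
     \<Rightarrow> ((nat \<Rightarrow> real \<Rightarrow> 'h) \<times> (nat \<Rightarrow> real \<Rightarrow> 'h)) set \<Rightarrow> bool" where
  "formally_normal Hs a b T \<longleftrightarrow>
     (\<forall>u. memL2S Hs a b u \<longrightarrow> (\<forall>\<epsilon>>0. \<exists>(v, f)\<in>T. sqnS a b (\<lambda>n t. u n t - v n t) < ennreal \<epsilon>))
     \<and> (\<forall>(u, f)\<in>T. \<exists>g. (u, g) \<in> adjL2S Hs a b T)
     \<and> (\<forall>(u, f)\<in>T. \<forall>g. (u, g) \<in> adjL2S Hs a b T \<longrightarrow> sqnS a b f = sqnS a b g)"

end

theory Submission
  imports Defs "HOL-Computational_Algebra.Polynomial"
begin

text \<open>On finite sums \<open>u = \<Sum>\<^sub>k \<phi>\<^sub>k x\<^sub>k\<close> both \<open>l(u) = - u'' + i A u\<close> and the formal adjoint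
  expression \<open>l\<^sup>+(u) = - u'' - i A u\<close> make sense, and \<open>l\<^sup>+\<close> is adjoint to \<open>l\<close> by partial integration. The real part
  of \<open>\<langle>- u'', i A u\<rangle>\<close> vanishes because \<open>- d\<^sup>2/dt\<^sup>2\<close> and \<open>A\<close> are symmetric and commute, hence
  \<open>\<parallel>l(u)\<parallel> = \<parallel>l\<^sup>+(u)\<parallel>\<close>. So if \<open>u\<^sub>k \<longlonglongrightarrow> u\<close> and \<open>l(u\<^sub>k)\<close> converges, then \<open>l\<^sup>+(u\<^sub>k)\<close> is Cauchy and its
  limit is the value of the adjoint at \<open>u\<close>, of the same norm; density of the finite sums makes
  this value unique.\<close>

section \<open>Smooth cut-off functions\<close>


text \<open>Only real inner products occur. \<open>J\<close> is orthogonal with square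
  \<open>-1\<close>, hence skew, and it commutes with \<open>A\<close>; so \<open>i A\<close> is
  skew for the real inner product, while \<open>- d^2/dt^2\<close> is symmetric. Acting on different
  tensor factors they commute, so their product is skew, and that is why the cross term vanishes.

  Elements of L2 are genuine functions here, not classes modulo null sets, and the ambient Hilbert
  space may be nonseparable. Two consequences shape the proof. A limit has to be produced as a
  strongly measurable function with values in \<open>H_n\<close> almost everywhere, so completeness
  is proved directly for such functions. And the adjoint value is determined only up to null sets,
  so uniqueness is phrased through square norms.

  Density of the finite sums has two independent sources: density of \<open>D(A_n)\<close> in
  \<open>H_n\<close> for the values, and density of test functions in scalar L2 for the dependence
  on \<open>t\<close>. The latter rests on \<open>exp (-1/x)\<close>; the direct sum adds only the
  truncation of a convergent series.\<close>

definition smooth_real :: "(real \<Rightarrow> real) \<Rightarrow> bool" where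
  "smooth_real f \<longleftrightarrow> (\<forall>k x. ((deriv ^^ k) f) differentiable (at x))"

lemma testfun_iff:
  "testfun a b \<phi> \<longleftrightarrow> smooth_real \<phi> \<and>
     (\<exists>c d. a < c \<and> c \<le> d \<and> d < b \<and> (\<forall>x. x \<notin> {c..d} \<longrightarrow> \<phi> x = 0))"
  by (simp add: testfun_def smooth_real_def)

lemma smooth_real_deriv: "smooth_real f \<Longrightarrow> smooth_real (deriv f)"
  unfolding smooth_real_def
proof (intro allI)
  fix k x assume "\<forall>k x. (deriv ^^ k) f differentiable at x"
  then have "(deriv ^^ Suc k) f differentiable at x" by blast
  then show "(deriv ^^ k) (deriv f) differentiable at x" by (simp only: funpow_Suc_right o_apply)
qed

lemma smooth_real_DERIV:
  assumes "smooth_real f" shows "(f has_real_derivative deriv f x) (at x)"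
proof -
  have "(deriv ^^ 0) f differentiable at x" using assms unfolding smooth_real_def by blast
  then show ?thesis by (simp add: DERIV_deriv_iff_real_differentiable)
qed

lemma smooth_real_continuous_on: "smooth_real f \<Longrightarrow> continuous_on S f"
  by (meson DERIV_isCont continuous_at_imp_continuous_on smooth_real_DERIV)

text \<open>Derivatives are unique, so the witness \<open>g'\<close> must be \<open>deriv g\<close>;
  a class that contains some derivative of each member therefore contains all iterated derivatives.
  This reduces smoothness to guessing a class stable under one derivation.\<close>

lemma smooth_real_coinduct:
  assumes "F f"
    and step: "\<And>g. F g \<Longrightarrow> \<exists>g'. F g' \<and> (\<forall>x. (g has_real_derivative g' x) (at x))"
  shows "smooth_real f"
proof -
  have F: "F ((deriv ^^ k) f)" for k
  proof (induction k)
    case (Suc k)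
    from step[OF Suc] obtain g' where g': "F g'" "\<And>x. ((deriv ^^ k) f has_real_derivative g' x) (at x)" by blast
    have "deriv ((deriv ^^ k) f) = g'" using g'(2) by (intro ext DERIV_imp_deriv)
    with g'(1) show ?case by simp
  qed (use assms in simp)
  show ?thesis unfolding smooth_real_def
    using step[OF F] real_differentiable_def by blast
qed

text \<open>The functions generated by smooth functions under sums and products are stable under
  derivation, so they are smooth by coinduction and no Leibniz formula for higher derivatives is needed.\<close>

inductive smooth_alg :: "(real \<Rightarrow> real) \<Rightarrow> bool" where
  base: "smooth_real f \<Longrightarrow> smooth_alg f"
| add: "smooth_alg f \<Longrightarrow> smooth_alg g \<Longrightarrow> smooth_alg (\<lambda>x. f x + g x)"
| mult: "smooth_alg f \<Longrightarrow> smooth_alg g \<Longrightarrow> smooth_alg (\<lambda>x. f x * g x)"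

lemma smooth_alg_DERIV:
  "smooth_alg f \<Longrightarrow> \<exists>f'. smooth_alg f' \<and> (\<forall>x. (f has_real_derivative f' x) (at x))"
proof (induction rule: smooth_alg.induct)
  case (base f)
  then show ?case by (blast intro: smooth_alg.base smooth_real_deriv smooth_real_DERIV)
next
  case (add f g)
  then obtain f' g' where "smooth_alg f'" "smooth_alg g'"
    "\<And>x. (f has_real_derivative f' x) (at x)" "\<And>x. (g has_real_derivative g' x) (at x)" by blast
  then show ?case
    by (intro exI[of _ "\<lambda>x. f' x + g' x"]) (auto intro: smooth_alg.intros DERIV_add)
next
  case (mult f g)
  then obtain f' g' where fg: "smooth_alg f'" "smooth_alg g'"
    "\<And>x. (f has_real_derivative f' x) (at x)" "\<And>x. (g has_real_derivative g' x) (at x)" by blast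
  have "smooth_alg (\<lambda>x. f' x * g x + g' x * f x)"
    using mult.hyps fg by (intro smooth_alg.intros(2,3))
  then show ?case using fg by (blast intro: DERIV_mult)
qed

lemma smooth_alg_imp_smooth: "smooth_alg f \<Longrightarrow> smooth_real f"
  by (rule smooth_real_coinduct[of smooth_alg]) (auto dest: smooth_alg_DERIV)

lemma smooth_real_add: "smooth_real f \<Longrightarrow> smooth_real g \<Longrightarrow> smooth_real (\<lambda>x. f x + g x)"
  by (rule smooth_alg_imp_smooth[OF smooth_alg.add[OF smooth_alg.base smooth_alg.base]])

lemma smooth_real_mult: "smooth_real f \<Longrightarrow> smooth_real g \<Longrightarrow> smooth_real (\<lambda>x. f x * g x)"
  by (rule smooth_alg_imp_smooth[OF smooth_alg.mult[OF smooth_alg.base smooth_alg.base]])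

lemma smooth_real_const: "smooth_real (\<lambda>x. c)"
  by (rule smooth_real_coinduct[of "\<lambda>f. \<exists>c. f = (\<lambda>x. c)"]) (auto intro!: derivative_eq_intros)

lemma smooth_real_ident: "smooth_real (\<lambda>x. x)"
proof (rule smooth_real_coinduct[of "\<lambda>f. smooth_real f \<or> f = (\<lambda>x. x)"])
  fix g :: "real \<Rightarrow> real" assume "smooth_real g \<or> g = (\<lambda>x. x)"
  then show "\<exists>g'. (smooth_real g' \<or> g' = (\<lambda>x. x)) \<and> (\<forall>x. (g has_real_derivative g' x) (at x))"
    using smooth_real_deriv smooth_real_DERIV smooth_real_const[of 1] DERIV_ident by blast
qed simp

lemma smooth_real_affine:
  assumes "smooth_real f" shows "smooth_real (\<lambda>x. f (c * x + d))"
\<comment> \<open>The scalar \<open>s\<close> belongs to the class because every application of the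
  chain rule produces a further factor \<open>c\<close>.\<close>
proof (rule smooth_real_coinduct[of "\<lambda>h. \<exists>f s. smooth_real f \<and> h = (\<lambda>x. s * f (c * x + d))"])
  show "\<exists>f' s. smooth_real f' \<and> (\<lambda>x. f (c * x + d)) = (\<lambda>x. s * f' (c * x + d))"
    using assms by (intro exI[of _ f] exI[of _ 1]) simp
next
  fix h assume "\<exists>f s. smooth_real f \<and> h = (\<lambda>x. s * f (c * x + d))"
  then obtain f s where f: "smooth_real f" and h: "h = (\<lambda>x. s * f (c * x + d))" by blast
  have "((\<lambda>x. f (c * x + d)) has_real_derivative deriv f (c * x + d) * c) (at x)" for x
    by (rule DERIV_chain2[OF smooth_real_DERIV[OF f]]) (auto intro!: derivative_eq_intros)
  then have "(h has_real_derivative (s * c) * deriv f (c * x + d)) (at x)" for x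
    unfolding h by (auto intro!: derivative_eq_intros)
  then show "\<exists>g'. (\<exists>f s. smooth_real f \<and> g' = (\<lambda>x. s * f (c * x + d))) \<and>
      (\<forall>x. (h has_real_derivative g' x) (at x))"
    using smooth_real_deriv[OF f] by (intro exI[of _ "\<lambda>x. (s * c) * deriv f (c * x + d)"]) blast
qed

lemma smooth_real_polynomial_function:
  assumes "real_polynomial_function (p :: real \<Rightarrow> real)" shows "smooth_real p"
  using assms
proof (induction rule: real_polynomial_function.induct)
  case (linear f)
  then obtain c where "f = (\<lambda>x. x * c)" by (auto simp: real_bounded_linear)
  then show ?case by (simp add: smooth_real_mult smooth_real_ident smooth_real_const)
qed (auto intro: smooth_real_const smooth_real_add smooth_real_mult)

text \<open>The classical \<open>exp (-1/x)\<close>, continued by 0, with a polynomial factor in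
  \<open>1/x\<close>. Only \<open>flat 1\<close> is used for the cut-off; the factor makes the
  family stable under derivation.\<close>

definition flat :: "real poly \<Rightarrow> real \<Rightarrow> real" where
  "flat p x = (if x > 0 then poly p (1 / x) * exp (- (1 / x)) else 0)"

lemma poly_div_exp_tendsto_0: "((\<lambda>y. poly p y / exp y) \<longlongrightarrow> (0::real)) at_top"
proof -
  have "((\<lambda>y. \<Sum>i\<le>degree p. coeff p i * (y ^ i / exp y)) \<longlongrightarrow> (\<Sum>i\<le>degree p. coeff p i * 0)) at_top"
    by (intro tendsto_sum tendsto_mult tendsto_const tendsto_power_div_exp_0)
  then show ?thesis by (simp add: poly_altdef sum_divide_distrib)
qed

lemma flat_tendsto_0: "(flat p \<longlongrightarrow> 0) (at 0)"
proof -
  have *: "((\<lambda>x. poly p (inverse x) / exp (inverse x)) \<longlongrightarrow> 0) (at_right (0::real))"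
    by (rule filterlim_compose[OF poly_div_exp_tendsto_0 filterlim_inverse_at_top_right])
  have "(flat p \<longlongrightarrow> 0) (at_right 0)"
    by (rule tendsto_cong[THEN iffD1, OF _ *])
       (auto simp: flat_def eventually_at_filter exp_minus divide_simps)
  moreover have "(flat p \<longlongrightarrow> 0) (at_left 0)"
    by (rule tendsto_cong[THEN iffD1, OF _ tendsto_const[of 0]])
       (auto simp: flat_def eventually_at_filter)
  ultimately show ?thesis using filterlim_at_split by blast
qed

text \<open>With \<open>y = 1/x\<close> one has \<open>d/dx = - y^2 d/dy\<close>, and
  \<open>d/dy\<close> turns \<open>p(y) exp(-y)\<close> into \<open>(p' - p)(y) exp(-y)\<close>. The
  factor \<open>y^2\<close> is \<open>monom 1 2\<close>.\<close>

lemma flat_DERIV: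
  "(flat p has_real_derivative flat (monom 1 2 * (p - pderiv p)) x) (at x)"
proof -
  consider "x < 0" | "x = 0" | "x > 0" by linarith
  then show ?thesis
  proof cases
    case 1
    have "((\<lambda>x. 0) has_real_derivative 0) (at x)" by simp
    moreover have "eventually (\<lambda>y. 0 = flat p y) (nhds x)"
      using eventually_nhds_in_open[of "{..<0}" x] 1 by (auto elim!: eventually_mono simp: flat_def)
    ultimately have "(flat p has_real_derivative 0) (at x)"
      using DERIV_cong_ev[OF refl _ refl, of "\<lambda>x. 0" "flat p" x 0] by simp
    then show ?thesis using 1 by (simp add: flat_def)
  next
    case 2
    \<comment> \<open>Dividing by \<open>h\<close> multiplies the polynomial by its variable
      \<open>1/h\<close>, which is \<open>pCons 0\<close>. The difference quotient at 0 is thus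
      itself a flat function, and tends to 0.\<close>
    have "(\<lambda>h. (flat p (0 + h) - flat p 0) / h) = flat (pCons 0 p)"
      by (auto simp: flat_def fun_eq_iff)
    then have "(flat p has_real_derivative 0) (at 0)"
      using flat_tendsto_0[of "pCons 0 p"] by (simp add: DERIV_def)
    then show ?thesis using 2 by (simp add: flat_def)
  next
    case 3
    have inv: "((\<lambda>x. 1 / x) has_real_derivative - (1 / x\<^sup>2)) (at x)"
      using 3 by (auto intro!: derivative_eq_intros simp: power2_eq_square)
    have "((\<lambda>x. poly p (1 / x) * exp (- (1 / x))) has_real_derivative
        (poly (pderiv p) (1 / x) * - (1 / x\<^sup>2)) * exp (- (1 / x))
          + (exp (- (1 / x)) * - (- (1 / x\<^sup>2))) * poly p (1 / x)) (at x)"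
      by (intro DERIV_mult DERIV_chain2[OF poly_DERIV inv] DERIV_chain2[OF DERIV_exp DERIV_minus[OF inv]])
    moreover have "(poly (pderiv p) (1 / x) * - (1 / x\<^sup>2)) * exp (- (1 / x))
          + (exp (- (1 / x)) * - (- (1 / x\<^sup>2))) * poly p (1 / x) = flat (monom 1 2 * (p - pderiv p)) x"
      using 3 by (simp add: flat_def poly_monom algebra_simps power_one_over)
    ultimately have "((\<lambda>x. poly p (1 / x) * exp (- (1 / x))) has_real_derivative
        flat (monom 1 2 * (p - pderiv p)) x) (at x)" by simp
    moreover have "eventually (\<lambda>y. poly p (1 / y) * exp (- (1 / y)) = flat p y) (nhds x)"
      using eventually_nhds_in_open[of "{0<..}" x] 3 by (auto elim!: eventually_mono simp: flat_def)
    ultimately show ?thesis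
      using DERIV_cong_ev[OF refl _ refl] by fast
  qed
qed

lemma smooth_real_flat: "smooth_real (flat p)"
  by (rule smooth_real_coinduct[of "\<lambda>f. \<exists>p. f = flat p"]) (use flat_DERIV in blast)+

text \<open>With \<open>M = m + 1\<close> the arguments are \<open>M (x - a) - 1\<close> and
  \<open>M (b - x) - 1\<close>, written in the form required by \<open>smooth_real_affine\<close>.
  The \<open>-1\<close> makes the product vanish within distance \<open>1/M\<close> of both end
  points; at a fixed inner point both arguments tend to infinity, where \<open>flat 1\<close> tends
  to 1.\<close>

definition cutoff :: "real \<Rightarrow> real \<Rightarrow> nat \<Rightarrow> real \<Rightarrow> real" where
  "cutoff a b m x = flat 1 (real (Suc m) * x + (- real (Suc m) * a - 1))
     * flat 1 (- real (Suc m) * x + (real (Suc m) * b - 1))"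

lemma flat_1_bounds: "0 \<le> flat 1 x" "flat 1 x \<le> 1"
  by (auto simp: flat_def)

lemma cutoff_bounds: "0 \<le> cutoff a b m x" "cutoff a b m x \<le> 1"
  by (simp_all add: cutoff_def flat_1_bounds mult_le_one)

lemma testfun_mult_cutoff:
  assumes "smooth_real p" "a < b" shows "testfun a b (\<lambda>x. p x * cutoff a b m x)"
  unfolding testfun_iff
proof (intro conjI)
  show "smooth_real (\<lambda>x. p x * cutoff a b m x)"
    unfolding cutoff_def
    by (intro smooth_real_mult smooth_real_affine smooth_real_flat assms)
  define M where "M = real (Suc m)"
  \<comment> \<open>The distance \<open>1 / M\<close> may exceed half the interval, and then the
    cut-off is identically 0. The second entry of the minimum keeps \<open>{a + r..b - r}\<close>
    nonempty also in that case, as \<open>testfun\<close> demands.\<close>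
  define r where "r = min (1 / M) ((b - a) / 2)"
  have M: "M > 0" by (simp add: M_def)
  have r: "r > 0" "r \<le> 1 / M" "r \<le> (b - a) / 2"
    using M assms(2) min.cobounded2[of "1 / M" "(b - a) / 2"] by (simp_all add: r_def)
  have "p x * cutoff a b m x = 0" if x: "x \<notin> {a + r..b - r}" for x
  proof -
    have "x \<le> a + 1 / M \<or> x \<ge> b - 1 / M" using x r by auto
    then have "M * x + (- M * a - 1) \<le> 0 \<or> - M * x + (M * b - 1) \<le> 0"
      using M by (auto simp: field_simps)
    then show ?thesis
      unfolding cutoff_def M_def[symmetric] by (auto simp: flat_def)
  qed
  moreover have "a < a + r" "a + r \<le> b - r" "b - r < b" using r by (auto simp: field_simps)
  ultimately show "\<exists>c d. a < c \<and> c \<le> d \<and> d < b \<and> (\<forall>x. x \<notin> {c..d} \<longrightarrow> p x * cutoff a b m x = 0)"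
    by blast
qed

lemma flat_1_tendsto_1: "filterlim g at_top F \<Longrightarrow> ((\<lambda>m. flat 1 (g m)) \<longlongrightarrow> 1) F"
proof -
  assume g: "filterlim g at_top F"
  have "((\<lambda>m. exp (- inverse (g m))) \<longlongrightarrow> exp (- 0)) F"
    by (intro tendsto_intros filterlim_compose[OF tendsto_inverse_0_at_top g] ) (rule filterlim_ident)
  moreover have "eventually (\<lambda>m. exp (- inverse (g m)) = flat 1 (g m)) F"
    using filterlim_at_top_dense[THEN iffD1, OF g, rule_format, of 0]
    by (auto elim!: eventually_mono simp: flat_def inverse_eq_divide)
  ultimately show ?thesis using tendsto_cong by force
qed

lemma cutoff_tendsto_1:
  assumes "a < x" "x < b" shows "(\<lambda>m. cutoff a b m x) \<longlonglongrightarrow> 1"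
proof -
  have lim: "filterlim (\<lambda>m. real (Suc m) * c + (- 1)) at_top sequentially" if "c > 0" for c
  proof -
    have "filterlim (\<lambda>m. real (Suc m)) at_top sequentially"
      using filterlim_compose[OF filterlim_real_sequentially filterlim_Suc] .
    then have "filterlim (\<lambda>m. - 1 + c * real (Suc m)) at_top sequentially"
      by (intro filterlim_tendsto_add_at_top[OF tendsto_const]
          filterlim_tendsto_pos_mult_at_top[OF tendsto_const that])
    then show ?thesis by (simp add: mult.commute add.commute)
  qed
  have "(\<lambda>m. flat 1 (real (Suc m) * (x - a) + (- 1)) * flat 1 (real (Suc m) * (b - x) + (- 1))) \<longlonglongrightarrow> 1 * 1"
    using assms by (intro tendsto_mult flat_1_tendsto_1 lim) auto
  moreover have "real (Suc m) * (x - a) + (- 1) = real (Suc m) * x + (- real (Suc m) * a - 1)"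
    "real (Suc m) * (b - x) + (- 1) = - real (Suc m) * x + (real (Suc m) * b - 1)" for m
    by (simp_all add: algebra_simps)
  ultimately show ?thesis by (simp only: cutoff_def mult_1)
qed

section \<open>Derivatives of test functions and partial integration\<close>

lemma testfun_deriv: "testfun a b \<phi> \<Longrightarrow> testfun a b (deriv \<phi>)"
  unfolding testfun_iff
proof (elim conjE exE, intro conjI)
  fix c d assume s: "smooth_real \<phi>" and cd: "a < c" "c \<le> d" "d < b" "\<forall>x. x \<notin> {c..d} \<longrightarrow> \<phi> x = 0"
  show "smooth_real (deriv \<phi>)" using s by (rule smooth_real_deriv)
  have "deriv \<phi> x = 0" if "x \<notin> {c..d}" for x
  proof -
    have "eventually (\<lambda>y. y \<in> - {c..d}) (nhds x)"
      using that by (intro eventually_nhds_in_open) auto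
    then have "eventually (\<lambda>y. 0 = \<phi> y) (nhds x)" using cd by (auto elim!: eventually_mono)
    then have "(\<phi> has_real_derivative 0) (at x)"
      using DERIV_cong_ev[OF refl _ refl, of "\<lambda>x. 0" "\<phi>" x 0] by simp
    then show ?thesis by (rule DERIV_imp_deriv)
  qed
  with cd show "\<exists>c d. a < c \<and> c \<le> d \<and> d < b \<and> (\<forall>x. x \<notin> {c..d} \<longrightarrow> deriv \<phi> x = 0)" by blast
qed

lemma testfun_continuous_on: "testfun a b \<phi> \<Longrightarrow> continuous_on S \<phi>"
  by (simp add: testfun_iff smooth_real_continuous_on)

lemma testfun_set_integrable:
  assumes "testfun a b \<phi>" "testfun a b \<psi>"
  shows "set_integrable lebesgue {a<..<b} (\<lambda>t. \<phi> t * \<psi> t)"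
proof -
  have "continuous_on {a..b} (\<lambda>t. \<phi> t * \<psi> t)"
    by (intro continuous_intros testfun_continuous_on[OF assms(1)] testfun_continuous_on[OF assms(2)])
  then have "set_integrable lebesgue {a..b} (\<lambda>t. \<phi> t * \<psi> t)"
    using absolutely_integrable_continuous_real by blast
  then show ?thesis by (rule set_integrable_subset) auto
qed

text \<open>The difference of the two integrands is the derivative of the Wronskian
  \<open>\<phi>' \<psi> - \<phi> \<psi>'\<close>, which is 0 at both end points.\<close>

lemma testfun_deriv2_symmetric:
  assumes "testfun a b \<phi>" "testfun a b \<psi>" "a < b"
  shows "(LINT t:{a<..<b}|lebesgue. (deriv ^^ 2) \<phi> t * \<psi> t) = (LINT t:{a<..<b}|lebesgue. \<phi> t * (deriv ^^ 2) \<psi> t)"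
proof -
  let ?D = "deriv ^^ 2"
  have D2: "?D f = deriv (deriv f)" for f :: "real \<Rightarrow> real" by (simp add: numeral_2_eq_2)
  have s: "smooth_real \<phi>" "smooth_real \<psi>" using assms by (auto simp: testfun_iff)
  note t = testfun_deriv[OF assms(1)] testfun_deriv[OF assms(2)]
  note tt = t[THEN testfun_deriv]
  have int: "set_integrable lebesgue {a<..<b} (\<lambda>t. ?D \<phi> t * \<psi> t)"
    "set_integrable lebesgue {a<..<b} (\<lambda>t. \<phi> t * ?D \<psi> t)"
    unfolding D2 by (intro testfun_set_integrable assms tt)+
  have z: "\<phi> a = 0" "\<phi> b = 0" "\<psi> a = 0" "\<psi> b = 0"
    using assms by (auto simp: testfun_def)
  have W: "((\<lambda>t. deriv \<phi> t * \<psi> t - \<phi> t * deriv \<psi> t) has_vector_derivative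
      ?D \<phi> t * \<psi> t - \<phi> t * ?D \<psi> t) (at t within {a..b})" for t
  proof -
    have "((\<lambda>t. deriv \<phi> t * \<psi> t - \<phi> t * deriv \<psi> t) has_real_derivative
        (?D \<phi> t * \<psi> t + deriv \<psi> t * deriv \<phi> t) - (deriv \<phi> t * deriv \<psi> t + ?D \<psi> t * \<phi> t)) (at t)"
      unfolding D2 by (intro DERIV_diff DERIV_mult smooth_real_DERIV smooth_real_deriv s)
    then show ?thesis
      by (auto simp: has_real_derivative_iff_has_vector_derivative algebra_simps
          intro: has_vector_derivative_at_within)
  qed
  have "((\<lambda>t. ?D \<phi> t * \<psi> t - \<phi> t * ?D \<psi> t) has_integral
      (deriv \<phi> b * \<psi> b - \<phi> b * deriv \<psi> b) - (deriv \<phi> a * \<psi> a - \<phi> a * deriv \<psi> a)) {a..b}"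
    using \<open>a < b\<close>
    by (intro fundamental_theorem_of_calculus) (use W in simp_all)
  then have "((\<lambda>t. ?D \<phi> t * \<psi> t - \<phi> t * ?D \<psi> t) has_integral 0) {a<..<b}"
    using has_integral_Icc_iff_Ioo z by fastforce
  moreover have "((\<lambda>t. ?D \<phi> t * \<psi> t - \<phi> t * ?D \<psi> t) has_integral
     (LINT t:{a<..<b}|lebesgue. ?D \<phi> t * \<psi> t - \<phi> t * ?D \<psi> t)) {a<..<b}"
    using set_lebesgue_integral_eq_integral[OF set_integral_diff(1)[OF int]]
    by (auto simp: has_integral_iff)
  ultimately have "(LINT t:{a<..<b}|lebesgue. ?D \<phi> t * \<psi> t - \<phi> t * ?D \<psi> t) = 0"
    using has_integral_unique by blast
  then show ?thesis using set_integral_diff(2)[OF int] by simp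
qed

section \<open>Strongly measurable functions and the space L2\<close>


text \<open>The analogue of \<open>strongly_meas\<close> on the whole line for values in an
  arbitrary topological space. Sums, multiples, norms and inner products then all follow from one
  statement on composition with a continuous map, although their values lie in different
  spaces.\<close>

definition ae_simple :: "(real \<Rightarrow> 'b::topological_space) \<Rightarrow> bool" where
  "ae_simple u \<longleftrightarrow> (\<exists>s :: nat \<Rightarrow> real \<Rightarrow> 'b. (\<forall>k. simple_function lebesgue (s k)) \<and>
     (AE t in lebesgue. (\<lambda>k. s k t) \<longlonglongrightarrow> u t))"

lemma ae_simple_compose2:
  fixes u :: "real \<Rightarrow> 'b::topological_space" and v :: "real \<Rightarrow> 'c::topological_space"
    and F :: "'b \<Rightarrow> 'c \<Rightarrow> 'd::topological_space"
  assumes "ae_simple u" "ae_simple v" and F: "continuous_on UNIV (\<lambda>p. F (fst p) (snd p))"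
  shows "ae_simple (\<lambda>t. F (u t) (v t))"
proof -
  obtain s where s: "\<And>k. simple_function lebesgue (s k)" "AE t in lebesgue. (\<lambda>k. s k t) \<longlonglongrightarrow> u t"
    using assms(1) unfolding ae_simple_def by blast
  obtain r where r: "\<And>k. simple_function lebesgue (r k)" "AE t in lebesgue. (\<lambda>k. r k t) \<longlonglongrightarrow> v t"
    using assms(2) unfolding ae_simple_def by blast
  have "AE t in lebesgue. (\<lambda>k. F (s k t) (r k t)) \<longlonglongrightarrow> F (u t) (v t)"
    using s(2) r(2)
  proof eventually_elim
    case (elim t)
    have "(\<lambda>k. (s k t, r k t)) \<longlonglongrightarrow> (u t, v t)" using elim by (intro tendsto_Pair)
    from continuous_on_tendsto_compose[OF F this] show ?case by simp
  qed
  then show ?thesis unfolding ae_simple_def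
    using simple_function_compose2[OF s(1) r(1), of F] by (intro exI[of _ "\<lambda>k t. F (s k t) (r k t)"]) auto
qed

text \<open>Lebesgue measure is complete: whatever \<open>v\<close> does on the exceptional null
  set, its preimages there are measurable.\<close>

lemma borel_measurable_lebesgue_AE_cong:
  fixes u v :: "real \<Rightarrow> real"
  assumes u: "u \<in> borel_measurable lebesgue" and eq: "AE t in lebesgue. u t = v t"
  shows "v \<in> borel_measurable lebesgue"
proof (rule measurableI)
  obtain N where N: "\<And>t. t \<notin> N \<Longrightarrow> u t = v t" "N \<in> null_sets lebesgue"
    using AE_E3[OF eq] by auto
  fix A :: "real set" assume A: "A \<in> sets borel"
  have "v -` A \<inter> N \<in> null_sets lebesgue"
    by (rule null_sets_completion_subset[OF _ N(2)]) auto
  moreover have "u -` A \<inter> space lebesgue \<in> sets lebesgue"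
    by (rule measurable_sets[OF u A])
  ultimately have "(u -` A - N) \<union> (v -` A \<inter> N) \<in> sets lebesgue"
    using N(2) by (intro sets.Un sets.Diff) auto
  moreover have "(u -` A - N) \<union> (v -` A \<inter> N) = v -` A \<inter> space lebesgue"
    using N(1) by auto
  ultimately show "v -` A \<inter> space lebesgue \<in> sets lebesgue" by simp
qed simp

lemma borel_measurable_lebesgue_AE_limit:
  fixes u :: "real \<Rightarrow> real"
  assumes s: "\<And>k. s k \<in> borel_measurable lebesgue" and l: "AE t in lebesgue. (\<lambda>k. s k t) \<longlonglongrightarrow> u t"
  shows "u \<in> borel_measurable lebesgue"
proof (rule borel_measurable_lebesgue_AE_cong)
  show "(\<lambda>t. lim (\<lambda>k. s k t)) \<in> borel_measurable lebesgue"
    using s by measurable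
  show "AE t in lebesgue. lim (\<lambda>k. s k t) = u t"
    using l by eventually_elim (rule limI)
qed

lemma ae_simple_real_iff: "ae_simple u \<longleftrightarrow> (u :: real \<Rightarrow> real) \<in> borel_measurable lebesgue"
proof
  assume "ae_simple u"
  then show "u \<in> borel_measurable lebesgue"
    unfolding ae_simple_def
    using borel_measurable_lebesgue_AE_limit borel_measurable_simple_function by blast
next
  assume "u \<in> borel_measurable lebesgue"
  from borel_measurable_implies_sequence_metric[OF this, of 0]
  show "ae_simple u" unfolding ae_simple_def by auto
qed

lemma ae_simple_compose:
  assumes "ae_simple u" "continuous_on UNIV F" shows "ae_simple (\<lambda>t. F (u t))"
proof -
  have "continuous_on UNIV (\<lambda>p. F (fst p))"
    by (rule continuous_on_compose2[OF assms(2)]) (auto intro: continuous_intros)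
  then show ?thesis by (rule ae_simple_compose2[OF assms(1) assms(1)])
qed

context
  fixes S :: "real set"
  assumes S[measurable]: "S \<in> sets lebesgue"
begin

text \<open>Extension by 0 removes the set \<open>S\<close>. The real difference is that
  \<open>strongly_meas\<close> asks for Borel functions of finite range: a simple function of
  \<open>lebesgue\<close> agrees almost everywhere with one of \<open>lborel\<close>, and countably
  many exceptional null sets are still null.\<close>

lemma strongly_meas_iff: "strongly_meas S u \<longleftrightarrow> ae_simple (\<lambda>t. indicator S t *\<^sub>R u t)"
proof
  assume "strongly_meas S u"
  then obtain s where s: "\<And>k. finite (range (s k))" "\<And>k. s k \<in> borel_measurable lborel"
    "AE t in lebesgue. t \<in> S \<longrightarrow> (\<lambda>k. s k t) \<longlonglongrightarrow> u t" by (auto simp: strongly_meas_def)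
  have simp: "simple_function lebesgue (s k)" for k
    unfolding simple_function_def
  proof (intro conjI ballI)
    fix x
    have "s k -` {x} \<inter> space lborel \<in> sets lborel" by (rule measurable_sets[OF s(2)]) auto
    then show "s k -` {x} \<inter> space lebesgue \<in> sets lebesgue" by (simp add: sets_completionI_sets)
  qed (use s in simp)
  have "simple_function lebesgue (\<lambda>t. indicator S t *\<^sub>R s k t)" for k
    by (intro simple_function_compose2[where h="(*\<^sub>R)"] simp simple_function_indicator S)
  moreover have "AE t in lebesgue. (\<lambda>k. indicator S t *\<^sub>R s k t) \<longlonglongrightarrow> indicator S t *\<^sub>R u t"
    using s(3) by eventually_elim (auto simp: indicator_def)
  ultimately show "ae_simple (\<lambda>t. indicator S t *\<^sub>R u t)"
    unfolding ae_simple_def by (intro exI[of _ "\<lambda>k t. indicator S t *\<^sub>R s k t"]) simp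
next
  assume "ae_simple (\<lambda>t. indicator S t *\<^sub>R u t)"
  then obtain s where s: "\<And>k. simple_function lebesgue (s k)"
    "AE t in lebesgue. (\<lambda>k. s k t) \<longlonglongrightarrow> indicator S t *\<^sub>R u t" by (auto simp: ae_simple_def)
  have "\<exists>r. simple_function lborel r \<and> (AE t in lborel. s k t = r t)" for k
    by (rule completion_ex_simple_function[OF s(1)])
  then obtain r where r: "\<And>k. simple_function lborel (r k)" "\<And>k. AE t in lborel. s k t = r k t" by metis
  have "AE t in lebesgue. \<forall>k. s k t = r k t"
    using r(2) by (simp add: AE_all_countable AE_completion_iff)
  then have "AE t in lebesgue. t \<in> S \<longrightarrow> (\<lambda>k. r k t) \<longlonglongrightarrow> u t"
    using s(2) by eventually_elim (auto simp: indicator_def)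
  moreover have "finite (range (r k))" for k using simple_functionD(1)[OF r(1)[of k]] by simp
  moreover have "r k \<in> borel_measurable lborel" for k by (rule borel_measurable_simple_function[OF r(1)])
  ultimately show "strongly_meas S u" unfolding strongly_meas_def by (intro exI[of _ r]) simp
qed

lemma strongly_meas_add:
  assumes "strongly_meas S u" "strongly_meas S v" shows "strongly_meas S (\<lambda>t. u t + v t)"
  using ae_simple_compose2[OF assms[unfolded strongly_meas_iff], of "(+)"]
  by (simp add: strongly_meas_iff scaleR_add_right continuous_intros)

lemma strongly_meas_scaleR:
  assumes "strongly_meas S u" shows "strongly_meas S (\<lambda>t. c *\<^sub>R u t)"
  using ae_simple_compose[OF assms[unfolded strongly_meas_iff], of "(*\<^sub>R) c"]
  by (simp add: strongly_meas_iff continuous_intros mult.commute)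

lemma strongly_meas_diff:
  assumes "strongly_meas S u" "strongly_meas S v" shows "strongly_meas S (\<lambda>t. u t - v t)"
  using strongly_meas_add[OF assms(1) strongly_meas_scaleR[OF assms(2), of "-1"]] by simp

lemma strongly_meas_simple:
  assumes "simple_function lebesgue u" shows "strongly_meas S u"
proof -
  have "simple_function lebesgue (\<lambda>t. indicator S t *\<^sub>R u t)"
    by (intro simple_function_compose2[where h="(*\<^sub>R)"] assms simple_function_indicator S)
  then show ?thesis unfolding strongly_meas_iff ae_simple_def
    by (intro exI[of _ "\<lambda>_ t. indicator S t *\<^sub>R u t"]) simp
qed

lemma strongly_meas_inner:
  assumes "strongly_meas S u" "strongly_meas S v"
  shows "(\<lambda>t. indicator S t *\<^sub>R inner (u t) (v t)) \<in> borel_measurable lebesgue"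
proof -
  have "ae_simple (\<lambda>t. inner (indicator S t *\<^sub>R u t) (indicator S t *\<^sub>R v t))"
    by (rule ae_simple_compose2[OF assms[unfolded strongly_meas_iff]]) (intro continuous_intros)
  moreover have "inner (indicator S t *\<^sub>R u t) (indicator S t *\<^sub>R v t) = indicator S t *\<^sub>R inner (u t) (v t)" for t
    by (simp add: indicator_def)
  ultimately show ?thesis by (simp only: ae_simple_real_iff)
qed

lemma strongly_meas_norm [measurable]:
  assumes "strongly_meas S u"
  shows "(\<lambda>t. indicator S t * norm (u t)) \<in> borel_measurable lebesgue"
proof -
  have "ae_simple (\<lambda>t. norm (indicator S t *\<^sub>R u t))"
    by (rule ae_simple_compose[OF assms[unfolded strongly_meas_iff]]) (intro continuous_intros)
  then show ?thesis by (simp add: ae_simple_real_iff)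
qed

lemma strongly_meas_continuous_scaleR:
  assumes "continuous_on UNIV \<phi>" shows "strongly_meas S (\<lambda>t. \<phi> t *\<^sub>R x)"
proof -
  have "\<phi> \<in> borel_measurable lborel"
    using borel_measurable_continuous_onI[OF assms] by simp
  then have "\<phi> \<in> borel_measurable lebesgue"
    by (rule measurable_completion)
  then have "(\<lambda>t. indicator S t * \<phi> t) \<in> borel_measurable lebesgue" by measurable
  then have "ae_simple (\<lambda>t. indicator S t * \<phi> t)" by (simp add: ae_simple_real_iff)
  then have "ae_simple (\<lambda>t. (indicator S t * \<phi> t) *\<^sub>R x)"
    by (rule ae_simple_compose) (intro continuous_intros)
  then show ?thesis by (simp add: strongly_meas_iff)
qed

section \<open>The square norm \<open>sqn\<close>\<close>

lemma sqn_eq: "sqn S u = (\<integral>\<^sup>+ t. ennreal ((indicator S t * norm (u t))\<^sup>2) \<partial>lebesgue)"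
  unfolding sqn_def by (intro nn_integral_cong) (simp add: indicator_def)

text \<open>Dropping one square from the parallelogram law gives a substitute for Minkowski's
  inequality without square roots in \<open>ennreal\<close>. The factor 2 is harmless for
  convergence.\<close>

lemma sqn_add_le:
  fixes u v :: "real \<Rightarrow> 'b::{real_inner,complete_space}"
  assumes "strongly_meas S u" "strongly_meas S v"
  shows "sqn S (\<lambda>t. u t + v t) \<le> 2 * sqn S u + 2 * sqn S v"
proof -
  note [measurable] = strongly_meas_norm[OF assms(1)] strongly_meas_norm[OF assms(2)]
  have *: "(norm (x + y))\<^sup>2 \<le> 2 * (norm x)\<^sup>2 + 2 * (norm y)\<^sup>2" for x y :: 'b
  proof -
    have "(norm (x + y))\<^sup>2 + (norm (x - y))\<^sup>2 = 2 * (norm x)\<^sup>2 + 2 * (norm y)\<^sup>2"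
      by (simp add: power2_norm_eq_inner inner_add inner_diff)
    moreover have "0 \<le> (norm (x - y))\<^sup>2" by (rule zero_le_power2)
    ultimately show ?thesis by linarith
  qed
  then have "sqn S (\<lambda>t. u t + v t) \<le> (\<integral>\<^sup>+ t. 2 * ennreal ((indicator S t * norm (u t))\<^sup>2) +
      2 * ennreal ((indicator S t * norm (v t))\<^sup>2) \<partial>lebesgue)"
    unfolding sqn_eq
    by (intro nn_integral_mono)
       (use * in \<open>auto simp: indicator_def ennreal_mult[symmetric] ennreal_plus[symmetric] ennreal_numeral[symmetric]
         simp del: ennreal_plus ennreal_numeral intro!: ennreal_leI\<close>)
  also have "\<dots> = 2 * sqn S u + 2 * sqn S v"
    unfolding sqn_eq by (subst nn_integral_add) (simp_all add: nn_integral_cmult)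
  finally show ?thesis .
qed

lemma sqn_scaleR: "sqn S (\<lambda>t. c *\<^sub>R u t) \<le> ennreal (c\<^sup>2) * sqn S u" if "strongly_meas S u"
proof -
  note [measurable] = strongly_meas_norm[OF that]
  have "sqn S (\<lambda>t. c *\<^sub>R u t) = (\<integral>\<^sup>+ t. ennreal (c\<^sup>2) * ennreal ((indicator S t * norm (u t))\<^sup>2) \<partial>lebesgue)"
    unfolding sqn_eq
    by (intro nn_integral_cong) (simp add: ennreal_mult[symmetric] power_mult_distrib mult.left_commute)
  then show ?thesis unfolding sqn_eq by (simp add: nn_integral_cmult)
qed

lemma sqn_AE_cong:
  assumes "AE t in lebesgue. t \<in> S \<longrightarrow> norm (u t) = norm (v t)"
  shows "sqn S u = sqn S v"
  unfolding sqn_eq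
  by (intro nn_integral_cong_AE) (use assms in \<open>eventually_elim, auto simp: indicator_def\<close>)

lemma sqn_minus_commute: "sqn S (\<lambda>t. u t - v t) = sqn S (\<lambda>t. v t - u t)"
  by (intro sqn_AE_cong) (simp add: norm_minus_commute)

lemma sqn_triangle:
  assumes "strongly_meas S u" "strongly_meas S v" "strongly_meas S w"
  shows "sqn S (\<lambda>t. u t - w t) \<le> 2 * sqn S (\<lambda>t. u t - v t) + 2 * sqn S (\<lambda>t. v t - w t)"
  using sqn_add_le[OF strongly_meas_diff[OF assms(1,2)] strongly_meas_diff[OF assms(2,3)]] by simp

lemma sqn_dominated:
  assumes d: "\<And>k. strongly_meas S (d k)"
    and lim: "AE t in lebesgue. t \<in> S \<longrightarrow> (\<lambda>k. d k t) \<longlonglongrightarrow> 0"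
    and bound: "\<And>k. AE t in lebesgue. t \<in> S \<longrightarrow> norm (d k t) \<le> norm (B t)"
    and B: "strongly_meas S B" "sqn S B < \<infinity>"
  shows "(\<lambda>k. sqn S (d k)) \<longlonglongrightarrow> 0"
proof -
  note [measurable] = strongly_meas_norm[OF B(1)] strongly_meas_norm[OF d]
  have "(\<lambda>k. \<integral>\<^sup>+ t. ennreal ((indicator S t * norm (d k t))\<^sup>2) \<partial>lebesgue) \<longlonglongrightarrow> (\<integral>\<^sup>+ t. 0 \<partial>(lebesgue :: real measure))"
  proof (rule nn_integral_dominated_convergence[where w="\<lambda>t. ennreal ((indicator S t * norm (B t))\<^sup>2)"])
    show "AE t in lebesgue. ennreal ((indicator S t * norm (d k t))\<^sup>2) \<le> ennreal ((indicator S t * norm (B t))\<^sup>2)" for k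
      using bound[of k] by eventually_elim (auto simp: indicator_def intro!: ennreal_leI power_mono)
    show "AE t in lebesgue. (\<lambda>k. ennreal ((indicator S t * norm (d k t))\<^sup>2)) \<longlonglongrightarrow> 0"
      using lim
    proof eventually_elim
      case (elim t)
      have "(\<lambda>k. ennreal ((indicator S t * norm (d k t))\<^sup>2)) \<longlonglongrightarrow> ennreal (0\<^sup>2)" if "t \<in> S"
        using elim that by (intro tendsto_ennrealI tendsto_power) (auto intro: tendsto_norm_zero)
      then show ?case by (cases "t \<in> S") auto
    qed
    show "(\<integral>\<^sup>+ t. ennreal ((indicator S t * norm (B t))\<^sup>2) \<partial>lebesgue) < \<infinity>"
      using B(2) by (simp add: sqn_eq)
  qed measurable
  then show ?thesis by (simp add: sqn_eq)
qed

text \<open>\<open>memL2\<close> without the restriction of the values to a subspace, so that scalar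
  functions and functions with values in \<open>H\<close> share one calculus.\<close>

definition L2 :: "(real \<Rightarrow> 'b::{real_inner,complete_space}) \<Rightarrow> bool" where
  "L2 u \<longleftrightarrow> strongly_meas S u \<and> sqn S u < \<infinity>"

lemma L2_zero: "L2 (\<lambda>t. 0)"
  unfolding L2_def using strongly_meas_simple[of "\<lambda>t. 0"] by (simp add: sqn_eq)

lemma L2_add: "L2 u \<Longrightarrow> L2 v \<Longrightarrow> L2 (\<lambda>t. u t + v t)"
  unfolding L2_def using strongly_meas_add sqn_add_le
  by (auto intro!: le_less_trans[OF sqn_add_le] simp: ennreal_mult_less_top)

lemma L2_scaleR: "L2 u \<Longrightarrow> L2 (\<lambda>t. c *\<^sub>R u t)"
  unfolding L2_def using strongly_meas_scaleR
  by (auto intro!: le_less_trans[OF sqn_scaleR] simp: ennreal_mult_less_top)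

lemma L2_diff: "L2 u \<Longrightarrow> L2 v \<Longrightarrow> L2 (\<lambda>t. u t - v t)"
  using L2_add[OF _ L2_scaleR[of v "-1"]] by simp

lemma L2_norm_integrable:
  assumes "L2 u" shows "integrable lebesgue (\<lambda>t. (indicator S t * norm (u t))\<^sup>2)"
proof -
  note [measurable] = strongly_meas_norm[of u]
  show ?thesis using assms
    by (intro integrableI_bounded) (auto simp: L2_def sqn_eq)
qed

lemma L2_inner_integrable:
  fixes u v :: "real \<Rightarrow> 'b::{real_inner,complete_space}"
  assumes "L2 u" "L2 v" shows "set_integrable lebesgue S (\<lambda>t. inner (u t) (v t))"
  unfolding set_integrable_def
proof (rule Bochner_Integration.integrable_bound)
  show "integrable lebesgue (\<lambda>t. (indicator S t * norm (u t))\<^sup>2 + (indicator S t * norm (v t))\<^sup>2)"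
    by (intro Bochner_Integration.integrable_add L2_norm_integrable assms)
  show "(\<lambda>t. indicator S t *\<^sub>R inner (u t) (v t)) \<in> borel_measurable lebesgue"
    using assms by (intro strongly_meas_inner) (auto simp: L2_def)
  have *: "\<bar>inner x y\<bar> \<le> (norm x)\<^sup>2 + (norm y)\<^sup>2" for x y :: 'b
  proof -
    have "\<bar>inner x y\<bar> \<le> norm x * norm y" by (rule Cauchy_Schwarz_ineq2)
    also have "\<dots> \<le> (norm x)\<^sup>2 + (norm y)\<^sup>2"
    proof -
      have "2 * (norm x * norm y) \<le> (norm x)\<^sup>2 + (norm y)\<^sup>2"
        using sum_squares_bound[of "norm x" "norm y"] by simp
      moreover have "0 \<le> norm x * norm y" by simp
      ultimately show ?thesis by linarith
    qed
    finally show ?thesis .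
  qed
  show "AE t in lebesgue. norm (indicator S t *\<^sub>R inner (u t) (v t))
      \<le> norm ((indicator S t * norm (u t))\<^sup>2 + (indicator S t * norm (v t))\<^sup>2)"
    using * by (intro AE_I2) (auto simp: indicator_def)
qed

section \<open>The real inner product of L2\<close>

lemma ipL2_add_left:
  "L2 u \<Longrightarrow> L2 v \<Longrightarrow> L2 w \<Longrightarrow> ipL2 S (\<lambda>t. u t + v t) w = ipL2 S u w + ipL2 S v w"
  unfolding ipL2_def by (simp add: inner_add_left set_integral_add L2_inner_integrable)

lemma ipL2_scaleR_left: "ipL2 S (\<lambda>t. c *\<^sub>R u t) w = c * ipL2 S u w"
  unfolding ipL2_def by simp

lemma ipL2_diff_left:
  "L2 u \<Longrightarrow> L2 v \<Longrightarrow> L2 w \<Longrightarrow> ipL2 S (\<lambda>t. u t - v t) w = ipL2 S u w - ipL2 S v w"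
  unfolding ipL2_def by (simp add: inner_diff_left set_integral_diff L2_inner_integrable)

lemma ipL2_commute: "ipL2 S u v = ipL2 S v u"
  unfolding ipL2_def by (simp add: inner_commute)

lemma ipL2_add_right:
  "L2 u \<Longrightarrow> L2 v \<Longrightarrow> L2 w \<Longrightarrow> ipL2 S w (\<lambda>t. u t + v t) = ipL2 S w u + ipL2 S w v"
  using ipL2_add_left[of u v w] by (simp add: ipL2_commute)

lemma ipL2_diff_right:
  "L2 u \<Longrightarrow> L2 v \<Longrightarrow> L2 w \<Longrightarrow> ipL2 S w (\<lambda>t. u t - v t) = ipL2 S w u - ipL2 S w v"
  using ipL2_diff_left[of u v w] by (simp add: ipL2_commute)

lemma ipL2_scaleR_right: "ipL2 S w (\<lambda>t. c *\<^sub>R u t) = c * ipL2 S w u"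
  unfolding ipL2_def by simp

lemma ipL2_zero_left: "ipL2 S (\<lambda>t. 0) v = 0"
  by (simp add: ipL2_def)

lemma ipL2_self_nonneg: "0 \<le> ipL2 S u u"
  unfolding ipL2_def set_lebesgue_integral_def by (intro integral_nonneg_AE) simp

lemma sqn_eq_ipL2:
  assumes "L2 u" shows "sqn S u = ennreal (ipL2 S u u)"
proof -
  have "sqn S u = ennreal (\<integral>t. (indicator S t * norm (u t))\<^sup>2 \<partial>lebesgue)"
    unfolding sqn_eq by (rule nn_integral_eq_integral[OF L2_norm_integrable[OF assms]]) simp
  also have "(\<integral>t. (indicator S t * norm (u t))\<^sup>2 \<partial>lebesgue) = ipL2 S u u"
    unfolding ipL2_def set_lebesgue_integral_def
    by (intro Bochner_Integration.integral_cong) (auto simp: indicator_def power2_norm_eq_inner)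
  finally show ?thesis .
qed

text \<open>The square norm of \<open>u + r v\<close> is a nonnegative quadratic in
  \<open>r\<close>. The form is only semidefinite on functions, so a vanishing leading coefficient
  is a case of its own.\<close>

lemma ipL2_Cauchy_Schwarz:
  assumes u: "L2 u" and v: "L2 v"
  shows "(ipL2 S u v)\<^sup>2 \<le> ipL2 S u u * ipL2 S v v"
proof -
  have q: "0 \<le> ipL2 S v v * r\<^sup>2 + 2 * ipL2 S u v * r + ipL2 S u u" for r
  proof -
    have "0 \<le> ipL2 S (\<lambda>t. u t + r *\<^sub>R v t) (\<lambda>t. u t + r *\<^sub>R v t)" by (rule ipL2_self_nonneg)
    also have "\<dots> = ipL2 S u u + r * ipL2 S v u + r * (ipL2 S u v + r * ipL2 S v v)"
      using u v by (simp add: ipL2_add_left ipL2_add_right L2_add L2_scaleR ipL2_scaleR_left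
          ipL2_scaleR_right algebra_simps)
    also have "\<dots> = ipL2 S v v * r\<^sup>2 + 2 * ipL2 S u v * r + ipL2 S u u"
      unfolding ipL2_commute[of v u] by (simp add: power2_eq_square algebra_simps)
    finally show ?thesis .
  qed
  show ?thesis
  proof (cases "ipL2 S v v = 0")
    case True
    have "ipL2 S u v = 0"
    proof (rule ccontr)
      assume "ipL2 S u v \<noteq> 0"
      \<comment> \<open>Without its quadratic term the polynomial is affine in \<open>r\<close>; at
        this \<open>r\<close> it takes the value \<open>-1\<close>.\<close>
      with q[of "- (ipL2 S u u + 1) / (2 * ipL2 S u v)"] True show False by simp
    qed
    then show ?thesis using True by simp
  next
    case False
    then have pos: "ipL2 S v v > 0" using ipL2_self_nonneg[of v] by simp
    have "0 \<le> ipL2 S u u - (ipL2 S u v)\<^sup>2 / ipL2 S v v"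
      using q[of "- ipL2 S u v / ipL2 S v v"] pos by (simp add: power2_eq_square field_simps)
    then show ?thesis using pos by (simp add: field_simps)
  qed
qed

lemma sqn_tendsto_ipL2:
  assumes "\<And>k. L2 (us k)" "L2 u" "(\<lambda>k. sqn S (\<lambda>t. us k t - u t)) \<longlonglongrightarrow> 0"
  shows "(\<lambda>k. sqrt (ipL2 S (\<lambda>t. us k t - u t) (\<lambda>t. us k t - u t))) \<longlonglongrightarrow> 0"
proof -
  have "(\<lambda>k. ennreal (ipL2 S (\<lambda>t. us k t - u t) (\<lambda>t. us k t - u t))) \<longlonglongrightarrow> ennreal 0"
    using assms by (simp add: sqn_eq_ipL2 L2_diff)
  then have "(\<lambda>k. ipL2 S (\<lambda>t. us k t - u t) (\<lambda>t. us k t - u t)) \<longlonglongrightarrow> 0"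
    by (subst (asm) tendsto_ennreal_iff) (auto simp: ipL2_self_nonneg)
  then show ?thesis using tendsto_real_sqrt by fastforce
qed

lemma ipL2_abs_le: "L2 u \<Longrightarrow> L2 v \<Longrightarrow> \<bar>ipL2 S u v\<bar> \<le> sqrt (ipL2 S u u) * sqrt (ipL2 S v v)"
  using real_sqrt_le_mono[OF ipL2_Cauchy_Schwarz[of u v]] by (simp add: real_sqrt_mult)

lemma tendsto_ipL2:
  assumes u: "\<And>k. L2 (us k)" "L2 u" "(\<lambda>k. sqn S (\<lambda>t. us k t - u t)) \<longlonglongrightarrow> 0"
    and v: "\<And>k. L2 (vs k)" "L2 v" "(\<lambda>k. sqn S (\<lambda>t. vs k t - v t)) \<longlonglongrightarrow> 0"
  shows "(\<lambda>k. ipL2 S (us k) (vs k)) \<longlonglongrightarrow> ipL2 S u v"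
proof (rule LIM_zero_cancel, rule Lim_null_comparison)
  let ?N = "\<lambda>w. sqrt (ipL2 S w w)" and ?du = "\<lambda>k t. us k t - u t" and ?dv = "\<lambda>k t. vs k t - v t"
  have "norm (ipL2 S (us k) (vs k) - ipL2 S u v) \<le>
      ?N (?du k) * ?N (?dv k) + ?N (?du k) * ?N v + ?N u * ?N (?dv k)" for k
  proof -
    \<comment> \<open>Expanding around the limits leaves only norms of differences and of the fixed
      \<open>u\<close> and \<open>v\<close>, so no bound on the two sequences is required.\<close>
    have "ipL2 S (us k) (vs k) - ipL2 S u v = ipL2 S (?du k) (?dv k) + ipL2 S (?du k) v + ipL2 S u (?dv k)"
      using u v by (simp add: ipL2_diff_left ipL2_diff_right L2_diff)
    then show ?thesis
      using ipL2_abs_le[of "?du k" "?dv k"] ipL2_abs_le[of "?du k" v] ipL2_abs_le[of u "?dv k"] u v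
      by (simp add: L2_diff)
  qed
  then show "\<forall>\<^sub>F k in sequentially. norm (ipL2 S (us k) (vs k) - ipL2 S u v) \<le>
      ?N (?du k) * ?N (?dv k) + ?N (?du k) * ?N v + ?N u * ?N (?dv k)" by simp
  show "(\<lambda>k. ?N (?du k) * ?N (?dv k) + ?N (?du k) * ?N v + ?N u * ?N (?dv k)) \<longlonglongrightarrow> 0"
    by (rule tendsto_eq_intros sqn_tendsto_ipL2 u v refl)+ simp
qed

lemma tendsto_sqn:
  assumes u: "\<And>k. L2 (us k)" "L2 u" "(\<lambda>k. sqn S (\<lambda>t. us k t - u t)) \<longlonglongrightarrow> 0"
  shows "(\<lambda>k. sqn S (us k)) \<longlonglongrightarrow> sqn S u"
  using tendsto_ipL2[OF u u] u by (simp add: sqn_eq_ipL2 tendsto_ennrealI)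

end

section \<open>Approximation and completeness\<close>


definition approximable ::
  "real set \<Rightarrow> ((real \<Rightarrow> 'b::{real_inner,complete_space}) \<Rightarrow> bool) \<Rightarrow> (real \<Rightarrow> 'b) \<Rightarrow> bool" where
  "approximable S P u \<longleftrightarrow> (\<forall>e>0. \<exists>v. P v \<and> sqn S (\<lambda>t. v t - u t) < ennreal e)"

lemma approximable_limit:
  assumes lim: "(\<lambda>k. sqn S (\<lambda>t. x k t - u t)) \<longlonglongrightarrow> 0" and P: "\<And>k. P (x k)"
  shows "approximable S P u"
  unfolding approximable_def
proof (intro allI impI)
  fix e :: real assume "e > 0"
  then have "eventually (\<lambda>k. sqn S (\<lambda>t. x k t - u t) < ennreal e) sequentially"
    by (intro order_tendstoD(2)[OF lim]) simp
  then obtain k where "sqn S (\<lambda>t. x k t - u t) < ennreal e"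
    using eventually_happens by fastforce
  then show "\<exists>v. P v \<and> sqn S (\<lambda>t. v t - u t) < ennreal e" using P by blast
qed

text \<open>Quarters, because the triangle inequality for \<open>sqn\<close> carries a factor 2 on
  each side.\<close>

lemma ennreal_two_halves_less:
  assumes "x < ennreal (e / 4)" "y < ennreal (e / 4)" "e > 0"
  shows "2 * x + 2 * y < ennreal e"
proof -
  have "2 * x < 2 * ennreal (e / 4)" "2 * y < 2 * ennreal (e / 4)"
    using assms by (auto intro!: ennreal_mult_strict_left_mono)
  then have "2 * x + 2 * y < 2 * ennreal (e / 4) + 2 * ennreal (e / 4)" by (rule add_strict_mono)
  also have "\<dots> = ennreal e"
    using assms(3) by (simp add: ennreal_mult[symmetric] ennreal_plus[symmetric] ennreal_numeral[symmetric]
        del: ennreal_plus ennreal_numeral)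
  finally show ?thesis .
qed

context
  fixes S :: "real set"
  assumes S[measurable]: "S \<in> sets lebesgue"
begin

lemma approximable_trans:
  assumes u: "approximable S Q u" "strongly_meas S u"
    and Q: "\<And>v. Q v \<Longrightarrow> strongly_meas S v" "\<And>v. Q v \<Longrightarrow> approximable S P v"
    and P: "\<And>v. P v \<Longrightarrow> strongly_meas S v"
  shows "approximable S P u"
  unfolding approximable_def
proof (intro allI impI)
  fix e :: real assume "e > 0"
  then have e: "e / 4 > 0" by simp
  obtain v where v: "Q v" "sqn S (\<lambda>t. v t - u t) < ennreal (e / 4)"
    using u(1) e unfolding approximable_def by blast
  obtain w where w: "P w" "sqn S (\<lambda>t. w t - v t) < ennreal (e / 4)"
    using Q(2)[OF v(1)] e unfolding approximable_def by blast
  have "sqn S (\<lambda>t. w t - u t) \<le> 2 * sqn S (\<lambda>t. w t - v t) + 2 * sqn S (\<lambda>t. v t - u t)"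
    by (rule sqn_triangle[OF S P[OF w(1)] Q(1)[OF v(1)] u(2)])
  also have "\<dots> < ennreal e" by (rule ennreal_two_halves_less[OF w(2) v(2) \<open>e > 0\<close>])
  finally show "\<exists>v. P v \<and> sqn S (\<lambda>t. v t - u t) < ennreal e" using w(1) by blast
qed

lemma approximable_add:
  assumes u: "approximable S P u" "strongly_meas S u" and v: "approximable S P v" "strongly_meas S v"
    and P: "\<And>v. P v \<Longrightarrow> strongly_meas S v" "\<And>v w. P v \<Longrightarrow> P w \<Longrightarrow> P (\<lambda>t. v t + w t)"
  shows "approximable S P (\<lambda>t. u t + v t)"
  unfolding approximable_def
proof (intro allI impI)
  fix e :: real assume "e > 0"
  then have e: "e / 4 > 0" by simp
  obtain x where x: "P x" "sqn S (\<lambda>t. x t - u t) < ennreal (e / 4)"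
    using u(1) e unfolding approximable_def by blast
  obtain y where y: "P y" "sqn S (\<lambda>t. y t - v t) < ennreal (e / 4)"
    using v(1) e unfolding approximable_def by blast
  have "sqn S (\<lambda>t. (x t - u t) + (y t - v t)) \<le> 2 * sqn S (\<lambda>t. x t - u t) + 2 * sqn S (\<lambda>t. y t - v t)"
    by (intro sqn_add_le[OF S] strongly_meas_diff[OF S] P(1) x y u v)
  also have "\<dots> < ennreal e" by (rule ennreal_two_halves_less[OF x(2) y(2) \<open>e > 0\<close>])
  also have "(\<lambda>t. (x t - u t) + (y t - v t)) = (\<lambda>t. (x t + y t) - (u t + v t))" by (simp add: fun_eq_iff)
  finally show "\<exists>w. P w \<and> sqn S (\<lambda>t. w t - (u t + v t)) < ennreal e" using P(2)[OF x(1) y(1)] by blast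
qed

text \<open>Fatou's lemma turns a Cauchy estimate for a sequence into an estimate of its distance to
  a limit that is known only pointwise.\<close>

lemma sqn_Fatou:
  assumes v: "\<And>i. strongly_meas S (v i)"
    and lim: "AE t in lebesgue. t \<in> S \<longrightarrow> (\<lambda>i. v i t) \<longlonglongrightarrow> w t"
    and le: "eventually (\<lambda>i. sqn S (v i) \<le> c) sequentially"
  shows "sqn S w \<le> c"
proof -
  note [measurable] = strongly_meas_norm[OF S v]
  have "sqn S w = (\<integral>\<^sup>+ t. liminf (\<lambda>i. ennreal ((indicator S t * norm (v i t))\<^sup>2)) \<partial>lebesgue)"
    unfolding sqn_eq[OF S]
  proof (intro nn_integral_cong_AE)
    show "AE t in lebesgue. ennreal ((indicator S t * norm (w t))\<^sup>2) =
        liminf (\<lambda>i. ennreal ((indicator S t * norm (v i t))\<^sup>2))"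
      using lim
    proof eventually_elim
      case (elim t)
      have "(\<lambda>i. ennreal ((indicator S t * norm (v i t))\<^sup>2)) \<longlonglongrightarrow> ennreal ((indicator S t * norm (w t))\<^sup>2)"
        using elim by (cases "t \<in> S") (auto intro!: tendsto_ennrealI tendsto_intros)
      from lim_imp_Liminf[OF sequentially_bot this] show ?case by (rule sym)
    qed
  qed
  also have "\<dots> \<le> liminf (\<lambda>i. \<integral>\<^sup>+ t. ennreal ((indicator S t * norm (v i t))\<^sup>2) \<partial>lebesgue)"
    by (intro nn_integral_liminf) measurable
  also have "\<dots> = liminf (\<lambda>i. sqn S (v i))" by (simp add: sqn_eq[OF S])
  also have "\<dots> \<le> limsup (\<lambda>i. sqn S (v i))" by (simp add: Liminf_le_Limsup)
  also have "\<dots> \<le> c" by (rule Limsup_bounded[OF le])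
  finally show ?thesis .
qed

text \<open>Near-best approximation moves the values of the given simple functions into \<open>D\<close>; cutting off
  where they exceed \<open>2 \<parallel>u(t)\<parallel>\<close> then provides a square integrable majorant.\<close>

lemma memL2_simple_approx:
  fixes u :: "real \<Rightarrow> 'b::{real_inner,complete_space}"
  assumes u: "memL2 H S u" and D: "H \<subseteq> closure D" "0 \<in> D"
  shows "approximable S (\<lambda>s. simple_function lebesgue s \<and> range s \<subseteq> D) u"
proof -
  have sm: "strongly_meas S u" and fin: "sqn S u < \<infinity>" and uH: "AE t in lebesgue. t \<in> S \<longrightarrow> u t \<in> H"
    using u by (auto simp: memL2_def)
  obtain s where s: "\<And>k. simple_function lebesgue (s k)"
    "AE t in lebesgue. (\<lambda>k. s k t) \<longlonglongrightarrow> indicator S t *\<^sub>R u t"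
    using sm unfolding strongly_meas_iff[OF S] by (auto simp: ae_simple_def)
  \<comment> \<open>The point \<open>y\<close> may depend on the value \<open>x\<close> and on
    \<open>k\<close>, but not on \<open>t\<close>: only then is its composition with a simple
    function simple. Hence it must compete with all \<open>z\<close> in \<open>H\<close> at once. A
    point of \<open>H\<close> within \<open>c\<close> of the infimal distance, followed by a point
    of \<open>D\<close> within \<open>c\<close> of it, costs
    \<open>2 c = 1 / (k + 1)\<close>.\<close>
  have "\<exists>y\<in>D. \<forall>z\<in>H. norm (y - x) \<le> norm (x - z) + 1 / real (Suc k)" for x and k :: nat
  proof (cases "H = {}")
    case False
    define c where "c = 1 / (2 * real (Suc k))"
    have c: "c > 0" "1 / real (Suc k) = c + c" by (simp_all add: c_def field_simps)
    have "\<exists>z\<in>H. dist x z < infdist x H + c"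
    proof (rule ccontr)
      assume "\<not> ?thesis"
      then have "infdist x H + c \<le> (INF z\<in>H. dist x z)"
        using False by (intro cINF_greatest) (auto simp: not_less)
      then show False using infdist_notempty[OF False, of x] c(1) by simp
    qed
    then obtain z where z: "z \<in> H" "dist x z < infdist x H + c" by blast
    have "z \<in> closure D" using z(1) D(1) by auto
    then obtain y where y: "y \<in> D" "dist y z < c"
      using closure_approachable c(1) by blast
    have "norm (y - x) \<le> norm (x - z') + 1 / real (Suc k)" if "z' \<in> H" for z'
    proof -
      have "dist y x \<le> dist y z + dist x z" by (metis dist_commute dist_triangle)
      also have "\<dots> \<le> dist x z' + (c + c)" using y z infdist_le[OF that, of x] by simp
      finally show ?thesis unfolding c(2) by (simp only: dist_norm)
    qed
    with y(1) show ?thesis by blast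
  qed (use D(2) in auto)
  then obtain y where y: "\<And>x k. y x k \<in> D" "\<And>x k z. z \<in> H \<Longrightarrow> norm (y x k - x) \<le> norm (x - z) + 1 / real (Suc k)"
    by metis
  \<comment> \<open>Any factor above 1 would do: where \<open>u t\<close> is not 0 the approximants
    eventually pass the test, and where it is 0 the truncated value is 0 at once. With 2, the
    majorant of the difference is \<open>3 u\<close>.\<close>
  define A where "A k = {t. norm (y (s k t) k) \<le> 2 * (indicator S t * norm (u t))}" for k
  define p where "p k t = (if t \<in> A k then y (s k t) k else 0)" for k t
  have q: "simple_function lebesgue (\<lambda>t. y (s k t) k)" for k
    using simple_function_compose1[OF s(1), of "\<lambda>x. y x k" k] .
  have Am: "A k \<in> sets lebesgue" for k
  proof -
    note [measurable] = strongly_meas_norm[OF S sm]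
    have [measurable]: "(\<lambda>t. norm (y (s k t) k)) \<in> borel_measurable lebesgue"
      using simple_function_compose1[OF q, of norm k] by (rule borel_measurable_simple_function)
    have "{t \<in> space lebesgue. norm (y (s k t) k) \<le> 2 * (indicator S t * norm (u t))} \<in> sets lebesgue"
      by measurable
    then show ?thesis by (simp add: A_def)
  qed
  have p: "simple_function lebesgue (p k)" for k
    unfolding p_def by (rule simple_function_If_set) (use q Am in auto)
  have pD: "range (p k) \<subseteq> D" for k using y(1) D(2) by (auto simp: p_def)
  have "(\<lambda>k. sqn S (\<lambda>t. p k t - u t)) \<longlonglongrightarrow> 0"
  proof (rule sqn_dominated[OF S])
    show "strongly_meas S (\<lambda>t. p k t - u t)" for k
      by (intro strongly_meas_diff[OF S] strongly_meas_simple[OF S] p sm)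
    show "strongly_meas S (\<lambda>t. 3 *\<^sub>R u t)" by (rule strongly_meas_scaleR[OF S sm])
    show "sqn S (\<lambda>t. 3 *\<^sub>R u t) < \<infinity>"
      using sqn_scaleR[OF S sm, of 3] fin by (auto intro: le_less_trans simp: ennreal_mult_less_top)
    show "AE t in lebesgue. t \<in> S \<longrightarrow> norm (p k t - u t) \<le> norm (3 *\<^sub>R u t)" for k
    proof (intro AE_I2 impI)
      fix t assume "t \<in> S"
      then have "norm (p k t) \<le> 2 * norm (u t)" by (auto simp: p_def A_def)
      then show "norm (p k t - u t) \<le> norm (3 *\<^sub>R u t)"
        using norm_triangle_ineq4[of "p k t" "u t"] by simp
    qed
    show "AE t in lebesgue. t \<in> S \<longrightarrow> (\<lambda>k. p k t - u t) \<longlonglongrightarrow> 0"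
      using s(2) uH
    proof eventually_elim
      case (elim t)
      show ?case
      proof
        assume t: "t \<in> S"
        then have lim: "(\<lambda>k. s k t) \<longlonglongrightarrow> u t" and ut: "u t \<in> H" using elim by auto
        define h where "h k = norm (s k t - u t) + norm (s k t - u t) + 1 / real (Suc k)" for k
        have n0: "(\<lambda>k. norm (s k t - u t)) \<longlonglongrightarrow> 0"
          by (rule tendsto_norm_zero[OF LIM_zero[OF lim]])
        have "h \<longlonglongrightarrow> 0 + 0 + 0"
          unfolding h_def
          by (rule tendsto_add[OF tendsto_add[OF n0 n0] LIMSEQ_inverse_real_of_nat[unfolded inverse_eq_divide]])
        then have h0: "h \<longlonglongrightarrow> 0" by simp
        have "norm (y (s k t) k - u t) \<le> h k" for k
        proof -
          have "norm (y (s k t) k - u t) \<le> norm (y (s k t) k - s k t) + norm (s k t - u t)"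
            using norm_triangle_ineq[of "y (s k t) k - s k t" "s k t - u t"] by simp
          also have "\<dots> \<le> (norm (s k t - u t) + 1 / real (Suc k)) + norm (s k t - u t)"
            by (intro add_right_mono y(2)[OF ut])
          finally show ?thesis by (simp add: h_def algebra_simps)
        qed
        then have "(\<lambda>k. y (s k t) k - u t) \<longlonglongrightarrow> 0"
          by (intro Lim_null_comparison[OF _ h0] always_eventually allI)
        then have yl: "(\<lambda>k. y (s k t) k) \<longlonglongrightarrow> u t" by (rule LIM_zero_cancel)
        have "(\<lambda>k. p k t) \<longlonglongrightarrow> u t"
        proof (cases "u t = 0")
          case True
          then have "p k t = 0" for k using t by (auto simp: p_def A_def)
          then show ?thesis using True by simp
        next
          case False
          then have "eventually (\<lambda>k. norm (y (s k t) k) < 2 * norm (u t)) sequentially"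
            by (intro order_tendstoD(2)[OF tendsto_norm[OF yl]]) simp
          then have "eventually (\<lambda>k. y (s k t) k = p k t) sequentially"
            by eventually_elim (use t in \<open>simp add: p_def A_def\<close>)
          with yl show ?thesis using tendsto_cong by fast
        qed
        then show "(\<lambda>k. p k t - u t) \<longlonglongrightarrow> 0" by (rule LIM_zero)
      qed
    qed
  qed
  then show ?thesis by (rule approximable_limit) (use p pD in auto)
qed

text \<open>Riesz-Fischer. Replacing \<open>w\<close> by simple functions first makes the pointwise limit strongly
  measurable; the weights \<open>2\<^sup>i\<close> force \<open>\<parallel>d\<^sub>i(t)\<parallel> \<le> C 2\<^sup>-\<^sup>i\<^sup>/\<^sup>2\<close>, hence convergence, for almost all \<open>t\<close>.\<close>

lemma memL2_complete:
  fixes w :: "nat \<Rightarrow> real \<Rightarrow> 'b::{real_inner,complete_space}"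
  assumes w: "\<And>k. memL2 H S (w k)" and H: "closed H" "0 \<in> H"
    and Cauchy: "\<And>e. e > 0 \<Longrightarrow> \<exists>N. \<forall>j\<ge>N. \<forall>k\<ge>N. sqn S (\<lambda>t. w j t - w k t) < ennreal e"
  shows "\<exists>g. memL2 H S g \<and> (\<lambda>k. sqn S (\<lambda>t. w k t - g t)) \<longlonglongrightarrow> 0"
proof -
  have wm: "strongly_meas S (w k)" for k using w by (simp add: memL2_def)
  \<comment> \<open>The set \<open>D\<close> is \<open>H\<close> itself here, so the simple
    functions take values in \<open>H\<close>; as \<open>H\<close> is closed, so does their
    pointwise limit.\<close>
  have "\<exists>s. (simple_function lebesgue s \<and> range s \<subseteq> H) \<and> sqn S (\<lambda>t. s t - w k t) < ennreal (1 / real (Suc k))" for k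
    using memL2_simple_approx[OF w closure_subset H(2)] unfolding approximable_def by simp
  then obtain s where s: "\<And>k. simple_function lebesgue (s k)" "\<And>k. range (s k) \<subseteq> H"
    "\<And>k. sqn S (\<lambda>t. s k t - w k t) < ennreal (1 / real (Suc k))" by metis
  have sm: "strongly_meas S (s k)" for k by (rule strongly_meas_simple[OF S s(1)])
  have close: "\<exists>N. \<forall>k\<ge>N. sqn S (\<lambda>t. s k t - w k t) < ennreal e" if "e > 0" for e
  proof -
    obtain N where N: "1 / real (Suc N) < e" using nat_approx_posE[OF \<open>e > 0\<close>] by auto
    have "sqn S (\<lambda>t. s k t - w k t) < ennreal e" if "k \<ge> N" for k
    proof -
      have "1 / real (Suc k) \<le> 1 / real (Suc N)" using that by (simp add: frac_le)
      then show ?thesis using N by (intro order.strict_trans2[OF s(3)[of k]] ennreal_leI) simp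
    qed
    then show ?thesis by blast
  qed
  have Cs: "\<exists>N. \<forall>j\<ge>N. \<forall>k\<ge>N. sqn S (\<lambda>t. s j t - s k t) < ennreal e" if "e > 0" for e
  proof -
    obtain N1 where N1: "\<forall>j\<ge>N1. \<forall>k\<ge>N1. sqn S (\<lambda>t. w j t - w k t) < ennreal (e / 4 / 4)"
      using Cauchy[of "e / 4 / 4"] \<open>e > 0\<close> by auto
    obtain N2 where N2: "\<forall>k\<ge>N2. sqn S (\<lambda>t. s k t - w k t) < ennreal (e / 4 / 4)"
      using close[of "e / 4 / 4"] \<open>e > 0\<close> by auto
    have "sqn S (\<lambda>t. s j t - s k t) < ennreal e" if jk: "j \<ge> max N1 N2" "k \<ge> max N1 N2" for j k
    proof -
      have "sqn S (\<lambda>t. w j t - s k t) \<le> 2 * sqn S (\<lambda>t. w j t - w k t) + 2 * sqn S (\<lambda>t. w k t - s k t)"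
        by (rule sqn_triangle[OF S wm wm sm])
      also have "\<dots> < ennreal (e / 4)"
        using N1 N2 jk \<open>e > 0\<close> by (intro ennreal_two_halves_less) (auto simp: sqn_minus_commute[OF S, of "w k" "s k"])
      finally have 1: "sqn S (\<lambda>t. w j t - s k t) < ennreal (e / 4)" .
      have "sqn S (\<lambda>t. s j t - w j t) < ennreal (e / 4 / 4)" using N2 jk by simp
      also have "\<dots> \<le> ennreal (e / 4)" using \<open>e > 0\<close> by (intro ennreal_leI) simp
      finally have 2: "sqn S (\<lambda>t. s j t - w j t) < ennreal (e / 4)" .
      have "sqn S (\<lambda>t. s j t - s k t) \<le> 2 * sqn S (\<lambda>t. s j t - w j t) + 2 * sqn S (\<lambda>t. w j t - s k t)"
        by (rule sqn_triangle[OF S sm wm sm])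
      also have "\<dots> < ennreal e" by (rule ennreal_two_halves_less[OF 2 1 \<open>e > 0\<close>])
      finally show ?thesis .
    qed
    then show ?thesis by blast
  qed
  \<comment> \<open>Against the weights \<open>2 ^ i\<close> the bound \<open>(1 / 4) ^ i\<close>
    still leaves the convergent series of \<open>(1 / 2) ^ i\<close>.\<close>
  have "\<forall>i::nat. \<exists>N. \<forall>j\<ge>N. \<forall>k\<ge>N. sqn S (\<lambda>t. s j t - s k t) < ennreal ((1 / 4) ^ i)"
    using Cs by simp
  then obtain N where N: "\<And>i j k. N i \<le> j \<Longrightarrow> N i \<le> k \<Longrightarrow> sqn S (\<lambda>t. s j t - s k t) < ennreal ((1 / 4) ^ i)"
    by metis
  \<comment> \<open>The partial sums make \<open>r\<close> nondecreasing and at least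
    \<open>N i\<close>; the summand \<open>i\<close> makes it tend to infinity even if
    \<open>N\<close> is bounded.\<close>
  define r where "r i = i + (\<Sum>l\<le>i. N l)" for i
  have rN: "N i \<le> r i" "r i \<le> r (Suc i)" "i \<le> r i" for i
    using member_le_sum[of i "{..i}" N] by (auto simp: r_def)
  define d where "d i t = s (r (Suc i)) t - s (r i) t" for i t
  have d: "sqn S (d i) \<le> ennreal ((1 / 4) ^ i)" for i
    unfolding d_def using N[of i "r (Suc i)" "r i"] rN[of i] by simp
  have dm: "strongly_meas S (d i)" for i unfolding d_def by (intro strongly_meas_diff[OF S] sm)
  note [measurable] = strongly_meas_norm[OF S dm]
  let ?F = "\<lambda>i t. ennreal (2 ^ i * (indicator S t * norm (d i t))\<^sup>2)"
  have "(\<integral>\<^sup>+ t. (\<Sum>i. ?F i t) \<partial>lebesgue) = (\<Sum>i. \<integral>\<^sup>+ t. ?F i t \<partial>lebesgue)"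
    by (intro nn_integral_suminf) measurable
  also have "\<dots> = (\<Sum>i. ennreal (2 ^ i) * sqn S (d i))"
    by (simp add: sqn_eq[OF S] ennreal_mult nn_integral_cmult)
  also have "\<dots> \<le> (\<Sum>i. ennreal ((1 / 2) ^ i))"
  proof (intro suminf_le summableI)
    fix i :: nat
    have "ennreal (2 ^ i) * sqn S (d i) \<le> ennreal (2 ^ i) * ennreal ((1 / 4) ^ i)"
      by (intro mult_left_mono d) simp
    also have "\<dots> = ennreal (2 ^ i * (1 / 4) ^ i)" by (rule ennreal_mult[symmetric]) simp_all
    also have "(2::real) ^ i * (1 / 4) ^ i = (2 * (1 / 4)) ^ i" by (rule power_mult_distrib[symmetric])
    also have "(2::real) * (1 / 4) = 1 / 2" by simp
    finally show "ennreal (2 ^ i) * sqn S (d i) \<le> ennreal ((1 / 2) ^ i)" .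
  qed
  also have "\<dots> < \<infinity>"
    unfolding infinity_ennreal_def less_top[symmetric]
    by (rule ennreal_suminf_neq_top) (simp_all add: summable_geometric)
  finally have "(\<integral>\<^sup>+ t. (\<Sum>i. ?F i t) \<partial>lebesgue) \<noteq> \<infinity>" by (rule less_imp_neq)
  moreover have "(\<lambda>t. \<Sum>i. ?F i t) \<in> borel_measurable lebesgue" by measurable
  ultimately have fin: "AE t in lebesgue. (\<Sum>i. ?F i t) \<noteq> \<infinity>"
    by (intro nn_integral_PInf_AE)
  have conv: "convergent (\<lambda>i. s (r i) t)" if t: "t \<in> S" "(\<Sum>i. ?F i t) \<noteq> \<infinity>" for t
  proof -
    have "summable (\<lambda>i. 2 ^ i * (norm (d i t))\<^sup>2)"
      by (rule summable_suminf_not_top) (use t in auto)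
    then have "bounded (range (\<lambda>i. 2 ^ i * (norm (d i t))\<^sup>2))"
      using summable_LIMSEQ_zero convergent_imp_bounded convergentI by blast
    then obtain C where C: "\<And>i. 2 ^ i * (norm (d i t))\<^sup>2 \<le> C"
      unfolding bounded_iff by (auto dest: abs_le_D1)
    have dle: "norm (d i t) \<le> sqrt C * sqrt (1 / 2) ^ i" for i
    proof (rule power2_le_imp_le)
      have C0: "C \<ge> 0" by (rule order_trans[OF _ C[of 0]]) simp
      have "(sqrt C * sqrt (1 / 2) ^ i)\<^sup>2 = C * (1 / 2) ^ i"
      proof -
        have "(sqrt (1 / 2) ^ i)\<^sup>2 = ((sqrt (1 / 2))\<^sup>2) ^ i" by (simp only: power_mult[symmetric] mult.commute)
        then show ?thesis using C0 by (simp add: power_mult_distrib)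
      qed
      moreover have "(norm (d i t))\<^sup>2 \<le> C * (1 / 2) ^ i"
        using mult_right_mono[OF C[of i], of "(1 / 2) ^ i"]
        by (simp add: power_one_over)
      ultimately show "(norm (d i t))\<^sup>2 \<le> (sqrt C * sqrt (1 / 2) ^ i)\<^sup>2" by simp
      show "0 \<le> sqrt C * sqrt (1 / 2) ^ i" using C0 by simp
    qed
    have "summable (\<lambda>i. norm (d i t))"
    proof (rule summable_comparison_test'[of "\<lambda>i. sqrt C * sqrt (1 / 2) ^ i" 0])
      have "sqrt (1 / 2) < sqrt 1" by (intro real_sqrt_less_mono) simp
      then show "summable (\<lambda>i. sqrt C * sqrt (1 / 2) ^ i)"
        by (intro summable_mult summable_geometric) simp
    qed (use dle in simp)
    then have "convergent (\<lambda>n. \<Sum>i<n. norm (d i t))" by (simp add: summable_iff_convergent)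
    then have Cp: "Cauchy (\<lambda>n. \<Sum>i<n. norm (d i t))" by (rule convergent_Cauchy)
    have tel: "dist (s (r m) t) (s (r n) t) \<le> dist (\<Sum>i<m. norm (d i t)) (\<Sum>i<n. norm (d i t))"
      if "m \<le> n" for m n
      using that
    proof (induction n rule: dec_induct)
      case (step n)
      have mono: "(\<Sum>i<m. norm (d i t)) \<le> (\<Sum>i<n. norm (d i t))"
        using step by (intro sum_mono2) auto
      have "dist (s (r m) t) (s (r (Suc n)) t) \<le> dist (s (r m) t) (s (r n) t) + dist (s (r n) t) (s (r (Suc n)) t)"
        by (rule dist_triangle)
      also have "dist (s (r n) t) (s (r (Suc n)) t) = norm (d n t)"
        by (simp add: d_def dist_norm norm_minus_commute)
      finally show ?case using step.IH mono by (simp add: dist_real_def)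
    qed simp
    have "Cauchy (\<lambda>i. s (r i) t)"
      unfolding Cauchy_def
    proof (intro allI impI)
      fix e :: real assume "e > 0"
      then obtain M where M: "\<forall>m\<ge>M. \<forall>n\<ge>M. dist (\<Sum>i<m. norm (d i t)) (\<Sum>i<n. norm (d i t)) < e"
        using Cp unfolding Cauchy_def by blast
      have L: "dist (s (r m) t) (s (r n) t) < e" if "m \<ge> M" "m \<le> n" for m n
        by (rule order.strict_trans1[OF tel[OF that(2)]]) (use M that in simp)
      have "dist (s (r m) t) (s (r n) t) < e" if "m \<ge> M" "n \<ge> M" for m n
      proof (cases "m \<le> n")
        case False
        then show ?thesis using L[OF that(2), of m] by (simp add: dist_commute)
      qed (rule L[OF that(1)])
      then show "\<exists>M. \<forall>m\<ge>M. \<forall>n\<ge>M. dist (s (r m) t) (s (r n) t) < e" by blast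
    qed
    then show ?thesis by (rule Cauchy_convergent)
  qed
  define g where "g t = lim (\<lambda>i. s (r i) t)" for t
  have lim: "AE t in lebesgue. t \<in> S \<longrightarrow> (\<lambda>i. s (r i) t) \<longlonglongrightarrow> g t"
    using fin
  proof eventually_elim
    case (elim t)
    show ?case unfolding g_def convergent_LIMSEQ_iff[symmetric] using conv[OF _ elim] by blast
  qed
  have gm: "strongly_meas S g"
    unfolding strongly_meas_iff[OF S] ae_simple_def
  proof (intro exI conjI allI)
    show "simple_function lebesgue (\<lambda>t. indicator S t *\<^sub>R s (r k) t)" for k
      by (intro simple_function_compose2[where h="(*\<^sub>R)"] s simple_function_indicator S)
    show "AE t in lebesgue. (\<lambda>k. indicator S t *\<^sub>R s (r k) t) \<longlonglongrightarrow> indicator S t *\<^sub>R g t"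
      using lim by eventually_elim (auto simp: indicator_def)
  qed
  have gH: "AE t in lebesgue. t \<in> S \<longrightarrow> g t \<in> H"
    using lim
  proof eventually_elim
    case (elim t)
    then show ?case using closed_sequentially[OF H(1), of "\<lambda>i. s (r i) t" "g t"] s(2) by auto
  qed
  have sg: "\<exists>N. \<forall>k\<ge>N. sqn S (\<lambda>t. s k t - g t) \<le> ennreal e" if e: "e > 0" for e
  proof -
    obtain M where M: "\<forall>j\<ge>M. \<forall>k\<ge>M. sqn S (\<lambda>t. s j t - s k t) < ennreal e" using Cs[OF e] by blast
    have "sqn S (\<lambda>t. s k t - g t) \<le> ennreal e" if k: "k \<ge> M" for k
    proof (rule sqn_Fatou)
      show "strongly_meas S (\<lambda>t. s k t - s (r i) t)" for i by (intro strongly_meas_diff[OF S] sm)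
      show "AE t in lebesgue. t \<in> S \<longrightarrow> (\<lambda>i. s k t - s (r i) t) \<longlonglongrightarrow> s k t - g t"
        using lim by eventually_elim (auto intro: tendsto_intros)
      show "\<forall>\<^sub>F i in sequentially. sqn S (\<lambda>t. s k t - s (r i) t) \<le> ennreal e"
        using eventually_ge_at_top[of M]
      proof eventually_elim
        case (elim i)
        then have "r i \<ge> M" using rN(3)[of i] by linarith
        then show ?case using M k by (simp add: order.strict_implies_order)
      qed
    qed
    then show ?thesis by blast
  qed
  have wg: "(\<lambda>k. sqn S (\<lambda>t. w k t - g t)) \<longlonglongrightarrow> 0"
  proof (rule tendsto_zero_ennreal)
    fix e :: real assume e: "e > 0"
    obtain N1 where N1: "\<forall>k\<ge>N1. sqn S (\<lambda>t. s k t - w k t) < ennreal (e / 4)"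
      using close[of "e / 4"] e by auto
    obtain N2 where N2: "\<forall>k\<ge>N2. sqn S (\<lambda>t. s k t - g t) \<le> ennreal (e / 8)"
      using sg[of "e / 8"] e by auto
    have "sqn S (\<lambda>t. w k t - g t) < ennreal e" if k: "k \<ge> max N1 N2" for k
    proof -
      have "sqn S (\<lambda>t. s k t - g t) \<le> ennreal (e / 8)" using N2 k by simp
      also have "\<dots> < ennreal (e / 4)" using e by (simp add: ennreal_lessI)
      finally have 2: "sqn S (\<lambda>t. s k t - g t) < ennreal (e / 4)" .
      have 1: "sqn S (\<lambda>t. w k t - s k t) < ennreal (e / 4)"
        using N1 k by (simp add: sqn_minus_commute[OF S, of "w k"])
      have "sqn S (\<lambda>t. w k t - g t) \<le> 2 * sqn S (\<lambda>t. w k t - s k t) + 2 * sqn S (\<lambda>t. s k t - g t)"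
        by (rule sqn_triangle[OF S wm sm gm])
      also have "\<dots> < ennreal e" by (rule ennreal_two_halves_less[OF 1 2 e])
      finally show ?thesis .
    qed
    then show "\<forall>\<^sub>F k in sequentially. sqn S (\<lambda>t. w k t - g t) < ennreal e"
      unfolding eventually_sequentially by blast
  qed
  have "sqn S g < \<infinity>"
  proof -
    obtain k where k: "sqn S (\<lambda>t. w k t - g t) < ennreal 1"
      using order_tendstoD(2)[OF wg, of "ennreal 1"] eventually_happens by fastforce
    have "sqn S g = sqn S (\<lambda>t. (g t - w k t) + w k t)" by simp
    also have "\<dots> \<le> 2 * sqn S (\<lambda>t. g t - w k t) + 2 * sqn S (w k)"
      by (intro sqn_add_le[OF S] strongly_meas_diff[OF S] wm gm)
    also have "\<dots> < \<infinity>"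
      using k w[of k] by (auto simp: memL2_def sqn_minus_commute[OF S, of g] ennreal_mult_less_top intro: less_trans)
    finally show ?thesis .
  qed
  with gm gH wg show ?thesis unfolding memL2_def by blast
qed

end

section \<open>Test functions approximate indicator functions\<close>


lemma Ioo_lebesgue: "{a<..<b::real} \<in> sets lebesgue"
  by simp

lemma L2_continuous_scaleR:
  assumes "continuous_on UNIV \<phi>" shows "L2 {a<..<b} (\<lambda>t. \<phi> t *\<^sub>R x)"
  unfolding L2_def[OF Ioo_lebesgue]
proof
  show "strongly_meas {a<..<b} (\<lambda>t. \<phi> t *\<^sub>R x)"
    by (rule strongly_meas_continuous_scaleR[OF Ioo_lebesgue assms])
  have "bounded (\<phi> ` {a..b})"
    by (intro compact_imp_bounded compact_continuous_image continuous_on_subset[OF assms]) auto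
  then obtain C where "\<forall>y\<in>\<phi> ` {a..b}. norm y \<le> C" unfolding bounded_iff by blast
  then have C: "\<bar>\<phi> t\<bar> \<le> C" if "t \<in> {a..b}" for t using that by simp
  have "sqn {a<..<b} (\<lambda>t. \<phi> t *\<^sub>R x) \<le> (\<integral>\<^sup>+ t. ennreal ((C * norm x)\<^sup>2) * indicator {a<..<b} t \<partial>lebesgue)"
    unfolding sqn_def
  proof (intro nn_integral_mono)
    fix t
    have "ennreal ((norm (\<phi> t *\<^sub>R x))\<^sup>2) \<le> ennreal ((C * norm x)\<^sup>2)" if "t \<in> {a<..<b}"
      using C[of t] that by (intro ennreal_leI power_mono) (auto intro: mult_right_mono)
    then show "ennreal ((norm (\<phi> t *\<^sub>R x))\<^sup>2) * indicator {a<..<b} t \<le> ennreal ((C * norm x)\<^sup>2) * indicator {a<..<b} t"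
      by (auto simp: indicator_def)
  qed
  also have "\<dots> < \<infinity>" by (cases "a \<le> b") (auto simp: nn_integral_cmult_indicator ennreal_mult_less_top)
  finally show "sqn {a<..<b} (\<lambda>t. \<phi> t *\<^sub>R x) < \<infinity>" .
qed

lemma L2_continuous: "continuous_on UNIV \<phi> \<Longrightarrow> L2 {a<..<b} (\<phi> :: real \<Rightarrow> real)"
  using L2_continuous_scaleR[of \<phi> a b "1::real"] by simp

lemma L2_strongly_meas: "L2 {a<..<b} u \<Longrightarrow> strongly_meas {a<..<b} u"
  by (simp add: L2_def[OF Ioo_lebesgue])

lemma strongly_meas_real:
  assumes "S \<in> sets lebesgue" "(f :: real \<Rightarrow> real) \<in> borel_measurable lebesgue"
  shows "strongly_meas S f"
proof -
  note [measurable] = assms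
  show ?thesis unfolding strongly_meas_iff[OF assms(1)] ae_simple_real_iff by measurable
qed

lemma approximable_continuous:
  assumes E: "E \<in> sets lebesgue"
  shows "approximable {a<..<b} (continuous_on UNIV) (indicator E :: real \<Rightarrow> real)"
proof -
  have Em: "(indicator E :: real \<Rightarrow> real) \<in> borel_measurable lebesgue" using E by measurable
  have "(indicator E :: real \<Rightarrow> real) measurable_on UNIV"
    by (rule lebesgue_measurable_imp_measurable_on_real[OF Em]) simp
  then obtain N g where N: "negligible N" and g: "\<And>n. continuous_on UNIV (g n)"
    "\<And>x. x \<notin> N \<Longrightarrow> (\<lambda>n. g n x) \<longlonglongrightarrow> (indicator E x :: real)"
    by (auto simp: measurable_on_def)
  \<comment> \<open>Truncation to \<open>[0, 1]\<close> does not move the limit, which is an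
    indicator, and supplies the majorant 1, square integrable on a bounded interval.\<close>
  define h where "h n x = max 0 (min 1 (g n x))" for n x
  have h: "continuous_on UNIV (h n)" for n unfolding h_def by (intro continuous_intros g)
  have "(\<lambda>k. sqn {a<..<b} (\<lambda>t. h k t - indicator E t)) \<longlonglongrightarrow> 0"
  proof (rule sqn_dominated[OF Ioo_lebesgue, where B="\<lambda>t. 1::real"])
    show "strongly_meas {a<..<b} (\<lambda>t. h k t - indicator E t)" for k
      by (intro strongly_meas_diff[OF Ioo_lebesgue] L2_strongly_meas L2_continuous h
          strongly_meas_real[OF Ioo_lebesgue Em])
    have "AE t in lebesgue. t \<notin> N" using N by (simp add: AE_not_in negligible_iff_null_sets)
    then show "AE t in lebesgue. t \<in> {a<..<b} \<longrightarrow> (\<lambda>k. h k t - indicator E t) \<longlonglongrightarrow> 0"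
    proof eventually_elim
      case (elim t)
      have "(\<lambda>k. h k t) \<longlonglongrightarrow> max 0 (min 1 (indicator E t))"
        unfolding h_def by (intro tendsto_intros g elim)
      also have "max 0 (min 1 (indicator E t)) = (indicator E t :: real)" by (simp add: indicator_def)
      finally show ?case by (simp add: LIM_zero)
    qed
    show "AE t in lebesgue. t \<in> {a<..<b} \<longrightarrow> norm (h k t - indicator E t) \<le> norm (1::real)" for k
      by (intro AE_I2) (auto simp: h_def indicator_def)
    show "strongly_meas {a<..<b} (\<lambda>t. 1::real)" "sqn {a<..<b} (\<lambda>t. 1::real) < \<infinity>"
      using L2_continuous[of "\<lambda>t. 1" a b] by (auto simp: L2_def[OF Ioo_lebesgue])
  qed
  then show ?thesis by (rule approximable_limit) (rule h)
qed

text \<open>Weierstrass approximation takes the place of mollification: polynomials are smooth, and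
  uniform closeness on \<open>{a..b}\<close> controls the square norm on the open interval. Compact
  support is restored afterwards by the cut-off.\<close>

lemma approximable_polynomial:
  assumes h: "continuous_on UNIV (h :: real \<Rightarrow> real)"
  shows "approximable {a<..<b} real_polynomial_function h"
proof -
  have "\<exists>p. real_polynomial_function p \<and> (\<forall>x\<in>{a..b}. \<bar>h x - p x\<bar> < 1 / real (Suc k))" for k
    using Stone_Weierstrass_real_polynomial_function[of "{a..b}" h "1 / real (Suc k)"]
      continuous_on_subset[OF h] by (metis compact_Icc of_nat_0_less_iff subset_UNIV zero_less_Suc zero_less_divide_1_iff)
  then obtain p where p: "\<And>k. real_polynomial_function (p k)"
    "\<And>k x. x \<in> {a..b} \<Longrightarrow> \<bar>h x - p k x\<bar> < 1 / real (Suc k)" by metis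
  have "(\<lambda>k. sqn {a<..<b} (\<lambda>t. p k t - h t)) \<longlonglongrightarrow> 0"
  proof (rule sqn_dominated[OF Ioo_lebesgue, where B="\<lambda>t. 1::real"])
    show "strongly_meas {a<..<b} (\<lambda>t. p k t - h t)" for k
      by (intro L2_strongly_meas L2_continuous continuous_intros h smooth_real_continuous_on
          smooth_real_polynomial_function p)
    show "AE t in lebesgue. t \<in> {a<..<b} \<longrightarrow> (\<lambda>k. p k t - h t) \<longlonglongrightarrow> 0"
    proof (intro AE_I2 impI)
      fix t assume "t \<in> {a<..<b}"
      then have "norm (p k t - h t) \<le> 1 / real (Suc k)" for k
        using p(2)[of t k] by (simp add: abs_minus_commute)
      then show "(\<lambda>k. p k t - h t) \<longlonglongrightarrow> 0"
        by (intro Lim_null_comparison[OF _ LIMSEQ_inverse_real_of_nat[unfolded inverse_eq_divide]] always_eventually allI)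
    qed
    show "AE t in lebesgue. t \<in> {a<..<b} \<longrightarrow> norm (p k t - h t) \<le> norm (1::real)" for k
    proof (intro AE_I2 impI)
      fix t assume "t \<in> {a<..<b}"
      then have "norm (p k t - h t) \<le> 1 / real (Suc k)"
        using p(2)[of t k] by (simp add: abs_minus_commute)
      also have "\<dots> \<le> norm (1::real)" by simp
      finally show "norm (p k t - h t) \<le> norm (1::real)" .
    qed
    show "strongly_meas {a<..<b} (\<lambda>t. 1::real)" "sqn {a<..<b} (\<lambda>t. 1::real) < \<infinity>"
      using L2_continuous[of "\<lambda>t. 1" a b] by (auto simp: L2_def[OF Ioo_lebesgue])
  qed
  then show ?thesis by (rule approximable_limit) (rule p)
qed

lemma approximable_cutoff:
  assumes p: "smooth_real p" and "a < b"
  shows "approximable {a<..<b} (testfun a b) p"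
proof -
  have "(\<lambda>k. sqn {a<..<b} (\<lambda>t. p t * cutoff a b k t - p t)) \<longlonglongrightarrow> 0"
  proof (rule sqn_dominated[OF Ioo_lebesgue, where B=p])
    show "strongly_meas {a<..<b} (\<lambda>t. p t * cutoff a b k t - p t)" for k
      by (intro L2_strongly_meas L2_continuous continuous_on_diff smooth_real_continuous_on[OF p]
          testfun_continuous_on[OF testfun_mult_cutoff[OF assms]])
    show "AE t in lebesgue. t \<in> {a<..<b} \<longrightarrow> (\<lambda>k. p t * cutoff a b k t - p t) \<longlonglongrightarrow> 0"
    proof (intro AE_I2 impI LIM_zero)
      fix t assume "t \<in> {a<..<b}"
      then have "(\<lambda>k. p t * cutoff a b k t) \<longlonglongrightarrow> p t * 1"
        by (intro tendsto_mult tendsto_const cutoff_tendsto_1) auto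
      then show "(\<lambda>k. p t * cutoff a b k t) \<longlonglongrightarrow> p t" by simp
    qed
    show "AE t in lebesgue. t \<in> {a<..<b} \<longrightarrow> norm (p t * cutoff a b k t - p t) \<le> norm (p t)" for k
    proof (intro AE_I2 impI)
      fix t
      have "\<bar>p t * cutoff a b k t - p t\<bar> = \<bar>p t\<bar> * \<bar>cutoff a b k t - 1\<bar>"
        by (simp add: abs_mult[symmetric] right_diff_distrib)
      also have "\<dots> \<le> \<bar>p t\<bar> * 1"
        using cutoff_bounds[of a b k t] by (intro mult_left_mono) auto
      finally show "norm (p t * cutoff a b k t - p t) \<le> norm (p t)" by simp
    qed
    show "strongly_meas {a<..<b} p" "sqn {a<..<b} p < \<infinity>"
      using L2_continuous[OF smooth_real_continuous_on[OF p], of a b] by (auto simp: L2_def[OF Ioo_lebesgue])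
  qed
  then show ?thesis by (rule approximable_limit) (rule testfun_mult_cutoff[OF assms])
qed

text \<open>A chain of three approximations: indicator by continuous function, continuous function
  by polynomial, polynomial by its product with a cut-off.\<close>

lemma approximable_testfun:
  assumes "E \<in> sets lebesgue" "a < b"
  shows "approximable {a<..<b} (testfun a b) (indicator E :: real \<Rightarrow> real)"
proof -
  have sm: "strongly_meas {a<..<b} (h :: real \<Rightarrow> real)" if "continuous_on UNIV h" for h
    using that by (intro L2_strongly_meas L2_continuous)
  have smE: "strongly_meas {a<..<b} (indicator E :: real \<Rightarrow> real)"
    by (rule strongly_meas_real[OF Ioo_lebesgue borel_measurable_indicator[OF assms(1)]])
  have cont: "approximable {a<..<b} (testfun a b) h" if h: "continuous_on UNIV h" for h
    by (rule approximable_trans[OF Ioo_lebesgue approximable_polynomial[OF h] sm[OF h]])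
       (auto intro: sm smooth_real_continuous_on smooth_real_polynomial_function testfun_continuous_on
          approximable_cutoff assms(2))
  show ?thesis
    by (rule approximable_trans[OF Ioo_lebesgue approximable_continuous[OF assms(1)] smE sm cont sm])
       (auto intro: testfun_continuous_on)
qed

lemma approximable_sequence:
  assumes "approximable S P u"
  shows "\<exists>x. (\<forall>k. P (x k)) \<and> (\<lambda>k. sqn S (\<lambda>t. x k t - u t)) \<longlonglongrightarrow> 0"
proof -
  have "\<forall>k. \<exists>v. P v \<and> sqn S (\<lambda>t. v t - u t) < ennreal (1 / real (Suc k))"
    using assms unfolding approximable_def by simp
  then obtain x where x: "\<And>k. P (x k)" "\<And>k. sqn S (\<lambda>t. x k t - u t) < ennreal (1 / real (Suc k))" by metis
  have "(\<lambda>k. sqn S (\<lambda>t. x k t - u t)) \<longlonglongrightarrow> 0"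
  proof (rule tendsto_sandwich[OF _ _ tendsto_const])
    show "(\<lambda>k. ennreal (1 / real (Suc k))) \<longlonglongrightarrow> 0"
      using tendsto_ennrealI[OF LIMSEQ_inverse_real_of_nat[unfolded inverse_eq_divide]] by simp
  qed (use x(2) in \<open>auto intro!: always_eventually order.strict_implies_order\<close>)
  with x(1) show ?thesis by blast
qed

section \<open>The minimal operator on one interval\<close>


lemma sqn_scaleR_right_le:
  fixes x :: "'b::{real_inner,complete_space}" and f :: "real \<Rightarrow> real"
  assumes S: "S \<in> sets lebesgue" and f: "strongly_meas S f"
  shows "sqn S (\<lambda>t. f t *\<^sub>R x) \<le> ennreal ((norm x)\<^sup>2) * sqn S f"
proof -
  have "sqn S (\<lambda>t. f t *\<^sub>R x) = sqn S (\<lambda>t. norm x *\<^sub>R f t)"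
    by (simp add: sqn_def abs_mult mult.commute)
  also have "\<dots> \<le> ennreal ((norm x)\<^sup>2) * sqn S f" by (rule sqn_scaleR[OF S f])
  finally show ?thesis .
qed

text \<open>A triple \<open>(u, d, e)\<close> of the core records \<open>u\<close> together with the two parts
  \<open>d = - u''\<close> and \<open>e = i A u\<close> of \<open>l(u)\<close>, so that the formal adjoint expression is \<open>d - e\<close>.\<close>

inductive core ::
  "('h::{real_inner,complete_space} \<Rightarrow> 'h) \<Rightarrow> ('h \<times> 'h) set \<Rightarrow> real \<Rightarrow> real \<Rightarrow>
    (real \<Rightarrow> 'h) \<Rightarrow> (real \<Rightarrow> 'h) \<Rightarrow> (real \<Rightarrow> 'h) \<Rightarrow> bool"
  for J A a b where
  zero: "core J A a b (\<lambda>t. 0) (\<lambda>t. 0) (\<lambda>t. 0)"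
| step: "core J A a b u d e \<Longrightarrow> testfun a b \<phi> \<Longrightarrow> (x, y) \<in> A \<Longrightarrow>
    core J A a b (\<lambda>t. u t + \<phi> t *\<^sub>R x) (\<lambda>t. d t + (- (deriv ^^ 2) \<phi> t) *\<^sub>R x) (\<lambda>t. e t + \<phi> t *\<^sub>R J y)"

lemma pre_min_iff:
  "(u, h) \<in> pre_min J A a b \<longleftrightarrow> (\<exists>(m::nat) \<phi> f g. u = (\<lambda>t. \<Sum>k<m. \<phi> k t *\<^sub>R f k) \<and>
     h = (\<lambda>t. \<Sum>k<m. (- (deriv ^^ 2) (\<phi> k) t) *\<^sub>R f k + \<phi> k t *\<^sub>R J (g k)) \<and>
     (\<forall>k<m. testfun a b (\<phi> k) \<and> (f k, g k) \<in> A))"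
  unfolding pre_min_def mem_Collect_eq prod.inject conj_assoc by (rule refl)

lemma core_imp_pre_min:
  "core J A a b u d e \<Longrightarrow> (u, \<lambda>t. d t + e t) \<in> pre_min J A a b"
proof (induction rule: core.induct)
  case zero
  show ?case unfolding pre_min_iff
    by (intro exI[of _ "0::nat"] exI[of _ "\<lambda>_ _. 0"] exI[of _ "\<lambda>_. 0"]) simp
next
  case (step u d e \<psi> x y)
  from step.IH obtain m :: nat and \<phi> f g where
    eq: "u = (\<lambda>t. \<Sum>k<m. \<phi> k t *\<^sub>R f k)"
      "(\<lambda>t. d t + e t) = (\<lambda>t. \<Sum>k<m. (- (deriv ^^ 2) (\<phi> k) t) *\<^sub>R f k + \<phi> k t *\<^sub>R J (g k))"
    and fg: "\<forall>k<m. testfun a b (\<phi> k) \<and> (f k, g k) \<in> A"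
    unfolding pre_min_iff by (elim exE conjE) (erule that)
  let ?\<phi> = "\<phi>(m := \<psi>)" and ?f = "f(m := x)" and ?g = "g(m := y)"
  have u: "(\<lambda>t. u t + \<psi> t *\<^sub>R x) = (\<lambda>t. \<Sum>k<Suc m. ?\<phi> k t *\<^sub>R ?f k)"
    unfolding eq(1) by (rule ext) simp
  have h: "(\<lambda>t. (d t + (- (deriv ^^ 2) \<psi> t) *\<^sub>R x) + (e t + \<psi> t *\<^sub>R J y)) =
      (\<lambda>t. \<Sum>k<Suc m. (- (deriv ^^ 2) (?\<phi> k) t) *\<^sub>R ?f k + ?\<phi> k t *\<^sub>R J (?g k))"
  proof
    fix t
    have "d t + e t = (\<Sum>k<m. (- (deriv ^^ 2) (\<phi> k) t) *\<^sub>R f k + \<phi> k t *\<^sub>R J (g k))"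
      using fun_cong[OF eq(2)] .
    then show "(d t + (- (deriv ^^ 2) \<psi> t) *\<^sub>R x) + (e t + \<psi> t *\<^sub>R J y) =
      (\<Sum>k<Suc m. (- (deriv ^^ 2) (?\<phi> k) t) *\<^sub>R ?f k + ?\<phi> k t *\<^sub>R J (?g k))"
      by (simp add: algebra_simps)
  qed
  have "\<forall>k<Suc m. testfun a b (?\<phi> k) \<and> (?f k, ?g k) \<in> A"
    using fg step.hyps by (auto simp: less_Suc_eq)
  then show ?case
    unfolding pre_min_iff u h
    by (intro exI[of _ "Suc m"] exI[of _ ?\<phi>] exI[of _ ?f] exI[of _ ?g]) simp
qed

text \<open>Building the sum term by term replaces later computations with double sums by
  inductions, and keeps apart the two parts of \<open>h\<close>, which \<open>h\<close> alone does
  not display.\<close>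

lemma pre_min_imp_core:
  assumes "(u, h) \<in> pre_min J A a b"
  shows "\<exists>d e. core J A a b u d e \<and> h = (\<lambda>t. d t + e t)"
proof -
  obtain m :: nat and \<phi> f g where u: "u = (\<lambda>t. \<Sum>k<m. \<phi> k t *\<^sub>R f k)"
    and h: "h = (\<lambda>t. \<Sum>k<m. (- (deriv ^^ 2) (\<phi> k) t) *\<^sub>R f k + \<phi> k t *\<^sub>R J (g k))"
    and fg: "\<forall>k<m. testfun a b (\<phi> k) \<and> (f k, g k) \<in> A"
    using assms unfolding pre_min_iff by (elim exE conjE) (erule that)
  have "core J A a b (\<lambda>t. \<Sum>k<n. \<phi> k t *\<^sub>R f k) (\<lambda>t. \<Sum>k<n. (- (deriv ^^ 2) (\<phi> k) t) *\<^sub>R f k)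
      (\<lambda>t. \<Sum>k<n. \<phi> k t *\<^sub>R J (g k))" if "n \<le> m" for n
    using that
  proof (induction n)
    case 0
    show ?case by (simp add: core.zero)
  next
    case (Suc n)
    then have "core J A a b (\<lambda>t. \<Sum>k<n. \<phi> k t *\<^sub>R f k) (\<lambda>t. \<Sum>k<n. (- (deriv ^^ 2) (\<phi> k) t) *\<^sub>R f k)
      (\<lambda>t. \<Sum>k<n. \<phi> k t *\<^sub>R J (g k))" "testfun a b (\<phi> n)" "(f n, g n) \<in> A" using fg by auto
    from core.step[OF this] show ?case by simp
  qed
  from this[OF order_refl] show ?thesis
    unfolding u h sum.distrib by blast
qed

locale min_op =
  fixes J :: "'h::{real_inner,complete_space} \<Rightarrow> 'h" and H :: "'h set" and A :: "('h \<times> 'h) set"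
    and a b :: real
  assumes cstruct: "cstruct J" and ab: "a < b" and csubspace: "csubspace J H"
    and selfadjoint: "selfadjoint_op J H A"
begin

abbreviation "I \<equiv> {a<..<b}"

lemmas I = Ioo_lebesgue[of a b]

lemma J: "linear J" "J (J x) = - x" "inner (J x) (J y) = inner x y"
  using cstruct by (auto simp: cstruct_def)

lemma H: "subspace H" "closed H" "x \<in> H \<Longrightarrow> J x \<in> H"
  using csubspace by (auto simp: csubspace_def)

lemma A_H: "(x, y) \<in> A \<Longrightarrow> x \<in> H" "(x, y) \<in> A \<Longrightarrow> y \<in> H"
  and A_J: "(x, y) \<in> A \<Longrightarrow> (J x, J y) \<in> A"
  and A_zero: "(0, 0) \<in> A"
  and A_scaleR: "(x, y) \<in> A \<Longrightarrow> (c *\<^sub>R x, c *\<^sub>R y) \<in> A"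
  and A_dense: "H \<subseteq> closure (Domain A)"
  using selfadjoint by (auto simp: selfadjoint_op_def lin_op_def)

lemma A_symmetric:
  assumes "(x, y) \<in> A" "(v, w) \<in> A" shows "inner y v = inner x w"
proof -
  have "(v, w) \<in> op_adj H A" using selfadjoint assms(2) by (simp add: selfadjoint_op_def)
  then show ?thesis using assms(1) by (auto simp: op_adj_def)
qed

text \<open>Moving \<open>J\<close> to the other side costs a sign, moving \<open>A\<close> costs
  none, and the two commute.\<close>

lemma A_J_skew:
  assumes "(x, y) \<in> A" "(v, w) \<in> A" shows "inner (J y) v = - inner x (J w)"
proof -
  have "inner (J y) v = inner (J (J y)) (J v)" by (simp only: J(3))
  also have "\<dots> = - inner y (J v)" by (simp add: J(2))
  also have "inner y (J v) = inner x (J w)" by (rule A_symmetric[OF assms(1) A_J[OF assms(2)]])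
  finally show ?thesis .
qed

lemma testfun_L2: "testfun a b \<phi> \<Longrightarrow> L2 I (\<lambda>t. \<phi> t *\<^sub>R x)"
  by (intro L2_continuous_scaleR testfun_continuous_on)

lemma testfun_deriv2: "testfun a b \<phi> \<Longrightarrow> testfun a b ((deriv ^^ 2) \<phi>)"
  by (simp add: numeral_2_eq_2 testfun_deriv)

lemma testfun_deriv2_L2: "testfun a b \<phi> \<Longrightarrow> L2 I (\<lambda>t. (- (deriv ^^ 2) \<phi> t) *\<^sub>R x)"
  using L2_scaleR[OF I testfun_L2[OF testfun_deriv2, of \<phi> x], of "-1"] by simp

lemma core_L2: "core J A a b u d e \<Longrightarrow> L2 I u \<and> L2 I d \<and> L2 I e"
proof (induction rule: core.induct)
  case (step u d e \<phi> x y)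
  then show ?case by (intro conjI L2_add[OF I] testfun_L2 testfun_deriv2_L2) simp_all
qed (simp add: L2_zero[OF I])

lemma core_H: "core J A a b u d e \<Longrightarrow> u t \<in> H \<and> d t \<in> H \<and> e t \<in> H"
proof (induction rule: core.induct)
  case (step u d e \<phi> x y)
  then show ?case using A_H[OF step.hyps(3)] H
    by (auto intro!: subspace_add subspace_scale H(3) simp del: scaleR_minus_left)
qed (simp add: H subspace_0)

lemma core_add:
  assumes "core J A a b u d e" "core J A a b u' d' e'"
  shows "core J A a b (\<lambda>t. u t + u' t) (\<lambda>t. d t + d' t) (\<lambda>t. e t + e' t)"
  using assms(2)
proof (induction rule: core.induct)
  case (step u' d' e' \<phi> x y)
  from core.step[OF step.IH step.hyps(2,3)] show ?case by (simp only: add.assoc)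
qed (simp add: assms(1))

lemma core_minus:
  "core J A a b u d e \<Longrightarrow> core J A a b (\<lambda>t. - u t) (\<lambda>t. - d t) (\<lambda>t. - e t)"
proof (induction rule: core.induct)
  case (step u d e \<phi> x y)
  have "(- x, - y) \<in> A" using A_scaleR[OF step.hyps(3), of "-1"] by simp
  from core.step[OF step.IH step.hyps(2) this] show ?case
    by (simp add: linear_neg[OF J(1)])
qed (simp add: core.zero)

lemma core_diff:
  assumes "core J A a b u d e" "core J A a b u' d' e'"
  shows "core J A a b (\<lambda>t. u t - u' t) (\<lambda>t. d t - d' t) (\<lambda>t. e t - e' t)"
  using core_add[OF assms(1) core_minus[OF assms(2)]] by simp

lemma ipL2_tensor:
  "ipL2 I (\<lambda>t. \<phi> t *\<^sub>R x) (\<lambda>t. \<psi> t *\<^sub>R y) = inner x y * (LINT t:I|lebesgue. \<phi> t * \<psi> t)"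
proof -
  have "ipL2 I (\<lambda>t. \<phi> t *\<^sub>R x) (\<lambda>t. \<psi> t *\<^sub>R y) = (LINT t:I|lebesgue. inner x y * (\<phi> t * \<psi> t))"
    unfolding ipL2_def by (intro arg_cong[where f="set_lebesgue_integral lebesgue I"] ext) simp
  then show ?thesis by simp
qed

text \<open>For two elementary tensors the inner product factorises by \<open>ipL2_tensor\<close>.
  The first identity is then the symmetry of the second derivative in the scalar factor, the second
  one the skewness of \<open>i A\<close> in the vector factor, and the third, for the cross term,
  uses both. Induction on the triple extends this to all of the core on the right.\<close>

lemma core_term:
  assumes "core J A a b u d e" and \<phi>: "testfun a b \<phi>" and xy: "(x, y) \<in> A"
  shows "ipL2 I (\<lambda>t. (- (deriv ^^ 2) \<phi> t) *\<^sub>R x) u = ipL2 I (\<lambda>t. \<phi> t *\<^sub>R x) d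
    \<and> ipL2 I (\<lambda>t. \<phi> t *\<^sub>R J y) u = - ipL2 I (\<lambda>t. \<phi> t *\<^sub>R x) e
    \<and> ipL2 I (\<lambda>t. (- (deriv ^^ 2) \<phi> t) *\<^sub>R x) e = - ipL2 I (\<lambda>t. \<phi> t *\<^sub>R J y) d"
  using assms(1)
proof (induction rule: core.induct)
  case zero
  show ?case by (simp add: ipL2_commute[OF I, of _ "\<lambda>t. 0"] ipL2_zero_left[OF I])
next
  case (step u d e \<psi> v w)
  note L = core_L2[OF step.hyps(1)]
  have add: "ipL2 I z (\<lambda>t. p t + q t) = ipL2 I z p + ipL2 I z q" if "L2 I z" "L2 I p" "L2 I q" for z p q :: "real \<Rightarrow> 'h"
    using that by (intro ipL2_add_right[OF I])
  note L' = testfun_L2[OF \<phi>] testfun_deriv2_L2[OF \<phi>] testfun_L2[OF step.hyps(2)] testfun_deriv2_L2[OF step.hyps(2)]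
  have D: "(LINT t:I|lebesgue. (- (deriv ^^ 2) \<phi> t) * \<psi> t) = (LINT t:I|lebesgue. \<phi> t * (- (deriv ^^ 2) \<psi> t))"
    using testfun_deriv2_symmetric[OF \<phi> step.hyps(2) ab] by (simp add: set_lebesgue_integral_def)
  show ?case
    using step.IH
    by (simp only: L L' add ipL2_tensor D A_J_skew[OF xy step.hyps(3)]) (simp add: algebra_simps)
qed

text \<open>The same three identities, extended by a second induction to the left argument.\<close>

lemma core_sym:
  assumes "core J A a b u d e" and c: "core J A a b u' d' e'"
  shows "ipL2 I d u' = ipL2 I u d' \<and> ipL2 I e u' = - ipL2 I u e' \<and> ipL2 I d e' = - ipL2 I e d'"
  using assms(1)
proof (induction rule: core.induct)
  case zero
  show ?case by (simp add: ipL2_zero_left[OF I])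
next
  case (step u d e \<phi> x y)
  note L = core_L2[OF step.hyps(1)] core_L2[OF c]
  note L' = testfun_L2[OF step.hyps(2)] testfun_deriv2_L2[OF step.hyps(2)]
  have add: "ipL2 I (\<lambda>t. p t + q t) z = ipL2 I p z + ipL2 I q z" if "L2 I z" "L2 I p" "L2 I q" for z p q :: "real \<Rightarrow> 'h"
    using that by (intro ipL2_add_left[OF I])
  show ?case
    using step.IH core_term[OF c step.hyps(2,3)] by (simp only: L L' add) simp
qed

lemma core_adjoint:
  assumes "core J A a b u d e" "core J A a b u' d' e'"
  shows "ipL2 I (\<lambda>t. d t + e t) u' = ipL2 I u (\<lambda>t. d' t - e' t)"
  using core_sym[OF assms] core_L2[OF assms(1)] core_L2[OF assms(2)]
  by (simp add: ipL2_add_left[OF I] ipL2_diff_right[OF I])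

text \<open>For a triple paired with itself the third part of \<open>core_sym\<close> says that the
  inner product of \<open>d\<close> and \<open>e\<close> equals its own negative. So
  \<open>d\<close> and \<open>e\<close> are orthogonal, and \<open>d - e\<close> and
  \<open>d + e\<close> have the same norm.\<close>

lemma core_norm:
  assumes "core J A a b u d e"
  shows "sqn I (\<lambda>t. d t - e t) = sqn I (\<lambda>t. d t + e t)"
proof -
  note L = core_L2[OF assms]
  have "ipL2 I d e = 0" using core_sym[OF assms assms] ipL2_commute[OF I, of d e] by simp
  then have "ipL2 I (\<lambda>t. d t - e t) (\<lambda>t. d t - e t) = ipL2 I (\<lambda>t. d t + e t) (\<lambda>t. d t + e t)"
    using L by (simp add: ipL2_add_left[OF I] ipL2_add_right[OF I] ipL2_diff_left[OF I] ipL2_diff_right[OF I]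
        L2_add[OF I] L2_diff[OF I] ipL2_commute[OF I, of e d])
  then show ?thesis using L by (simp add: sqn_eq_ipL2[OF I] L2_add[OF I] L2_diff[OF I])
qed

lemma memL2_L2: "memL2 H I u \<Longrightarrow> L2 I u"
  by (simp add: memL2_def L2_def[OF I])

lemma memL2_I: "L2 I u \<Longrightarrow> (\<And>t. u t \<in> H) \<Longrightarrow> memL2 H I u"
  by (simp add: memL2_def L2_def[OF I])

lemma memL2_diff:
  assumes "memL2 H I u" "memL2 H I v" shows "memL2 H I (\<lambda>t. u t - v t)"
proof -
  have "L2 I (\<lambda>t. u t - v t)" using assms by (intro L2_diff[OF I] memL2_L2)
  moreover have "AE t in lebesgue. t \<in> I \<longrightarrow> u t \<in> H" "AE t in lebesgue. t \<in> I \<longrightarrow> v t \<in> H"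
    using assms by (auto simp: memL2_def)
  then have "AE t in lebesgue. t \<in> I \<longrightarrow> u t - v t \<in> H"
    by eventually_elim (auto intro: subspace_diff H)
  ultimately show ?thesis by (simp add: memL2_def L2_def[OF I])
qed

lemma core_approximates_term:
  assumes E: "E \<in> sets lebesgue" and xy: "(x, y) \<in> A"
  shows "approximable I (\<lambda>v. \<exists>d e. core J A a b v d e) (\<lambda>t. indicator E t *\<^sub>R x)"
proof -
  obtain \<phi> where \<phi>: "\<And>k. testfun a b (\<phi> k)" "(\<lambda>k. sqn I (\<lambda>t. \<phi> k t - indicator E t)) \<longlonglongrightarrow> 0"
    using approximable_sequence[OF approximable_testfun[OF E ab]] by blast
  have m: "strongly_meas I (\<lambda>t. \<phi> k t - indicator E t)" for k
    by (intro strongly_meas_diff[OF I] L2_strongly_meas L2_continuous testfun_continuous_on[OF \<phi>(1)]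
        strongly_meas_real[OF I borel_measurable_indicator[OF E]])
  have "(\<lambda>k. sqn I (\<lambda>t. \<phi> k t *\<^sub>R x - indicator E t *\<^sub>R x)) \<longlonglongrightarrow> 0"
  proof (rule tendsto_sandwich[OF _ _ tendsto_const])
    show "\<forall>\<^sub>F k in sequentially. sqn I (\<lambda>t. \<phi> k t *\<^sub>R x - indicator E t *\<^sub>R x)
        \<le> ennreal ((norm x)\<^sup>2) * sqn I (\<lambda>t. \<phi> k t - indicator E t)"
      using sqn_scaleR_right_le[OF I m, where x=x] by (simp add: scaleR_diff_left)
    have "(\<lambda>k. ennreal ((norm x)\<^sup>2) * sqn I (\<lambda>t. \<phi> k t - indicator E t)) \<longlonglongrightarrow> ennreal ((norm x)\<^sup>2) * 0"
      by (intro ennreal_tendsto_cmult \<phi>) simp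
    then show "(\<lambda>k. ennreal ((norm x)\<^sup>2) * sqn I (\<lambda>t. \<phi> k t - indicator E t)) \<longlonglongrightarrow> 0" by simp
  qed simp
  moreover have "core J A a b (\<lambda>t. \<phi> k t *\<^sub>R x) (\<lambda>t. (- (deriv ^^ 2) (\<phi> k) t) *\<^sub>R x) (\<lambda>t. \<phi> k t *\<^sub>R J y)" for k
    using core.step[OF core.zero \<phi>(1) xy] by simp
  ultimately show ?thesis
    by (intro approximable_limit[where x="\<lambda>k t. \<phi> k t *\<^sub>R x"]) blast+
qed

lemma core_dense:
  assumes u: "memL2 H I u"
  shows "approximable I (\<lambda>v. \<exists>d e. core J A a b v d e) u"
proof (rule approximable_trans[OF I memL2_simple_approx[OF I u A_dense]])
  show "0 \<in> Domain A" using A_zero by blast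
  show "strongly_meas I u" using u by (simp add: memL2_def)
  show "strongly_meas I v" if "\<exists>d e. core J A a b v d e" for v
    using that core_L2 L2_strongly_meas by blast
  fix s :: "real \<Rightarrow> 'h" assume s: "simple_function lebesgue s \<and> range s \<subseteq> Domain A"
  show "strongly_meas I s" using s by (intro strongly_meas_simple[OF I]) simp
  have fin: "finite (range s)" using simple_functionD(1)[of lebesgue s] s by simp
  \<comment> \<open>Simplicity of the partial sums is carried through the induction because
    \<open>approximable_add\<close> needs them strongly measurable.\<close>
  have ind: "simple_function lebesgue (\<lambda>t. \<Sum>x\<in>F. indicator (s -` {x}) t *\<^sub>R x)
      \<and> approximable I (\<lambda>v. \<exists>d e. core J A a b v d e) (\<lambda>t. \<Sum>x\<in>F. indicator (s -` {x}) t *\<^sub>R x)"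
    if "finite F" "F \<subseteq> Domain A" for F
    using that
  proof (induction F rule: finite_induct)
    case empty
    have "approximable I (\<lambda>v. \<exists>d e. core J A a b v d e) (\<lambda>t. 0)"
    proof (rule approximable_limit[where x="\<lambda>k t. 0"])
      show "\<exists>d e. core J A a b (\<lambda>t. 0) d e" using core.zero by blast
    qed (simp add: sqn_def)
    then show ?case by simp
  next
    case (insert x F)
    have E: "s -` {x} \<in> sets lebesgue" using simple_functionD(2)[of lebesgue s "{x}"] s by simp
    have sf: "simple_function lebesgue (\<lambda>t. indicator (s -` {x}) t *\<^sub>R x)"
      using simple_function_compose1[OF simple_function_indicator[OF E], of "\<lambda>c. c *\<^sub>R x"] .
    obtain y where "(x, y) \<in> A" using insert.prems by blast
    note ap = core_approximates_term[OF E this]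
    have IH: "simple_function lebesgue (\<lambda>t. \<Sum>x\<in>F. indicator (s -` {x}) t *\<^sub>R x)"
      "approximable I (\<lambda>v. \<exists>d e. core J A a b v d e) (\<lambda>t. \<Sum>x\<in>F. indicator (s -` {x}) t *\<^sub>R x)"
      using insert by auto
    have "approximable I (\<lambda>v. \<exists>d e. core J A a b v d e)
      (\<lambda>t. indicator (s -` {x}) t *\<^sub>R x + (\<Sum>x\<in>F. indicator (s -` {x}) t *\<^sub>R x))"
      by (rule approximable_add[OF I ap strongly_meas_simple[OF I sf] IH(2) strongly_meas_simple[OF I IH(1)]])
         (use core_L2 L2_strongly_meas core_add in blast)+
    moreover have "simple_function lebesgue
      (\<lambda>t. indicator (s -` {x}) t *\<^sub>R x + (\<Sum>x\<in>F. indicator (s -` {x}) t *\<^sub>R x))"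
      by (rule simple_function_compose2[where h="(+)", OF sf IH(1)])
    ultimately show ?case unfolding sum.insert[OF insert.hyps(1,2)] by blast
  qed
  have "(\<Sum>x\<in>range s. indicator (s -` {x}) t *\<^sub>R x) = s t" for t
  proof -
    have "(\<Sum>x\<in>range s. indicator (s -` {x}) t *\<^sub>R x) = (\<Sum>x\<in>range s. if x = s t then x else 0)"
      by (intro sum.cong) (auto simp: indicator_def)
    then show ?thesis using fin by simp
  qed
  then have "(\<lambda>t. \<Sum>x\<in>range s. indicator (s -` {x}) t *\<^sub>R x) = s" by (rule ext)
  moreover have "range s \<subseteq> Domain A" using s by blast
  ultimately show "approximable I (\<lambda>v. \<exists>d e. core J A a b v d e) s"
    using ind[OF fin] by (simp only:)
qed

text \<open>\<open>w\<close> is itself a limit of core functions \<open>v k\<close>, so the zeros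
  \<open>ipL2 I (v k) w\<close> converge to \<open>ipL2 I w w\<close>.\<close>

lemma core_orthogonal_zero:
  assumes w: "memL2 H I w" and orth: "\<And>v d e. core J A a b v d e \<Longrightarrow> ipL2 I v w = 0"
  shows "sqn I w = 0"
proof -
  obtain v where v: "\<And>k. \<exists>d e. core J A a b (v k) d e" "(\<lambda>k. sqn I (\<lambda>t. v k t - w t)) \<longlonglongrightarrow> 0"
    using approximable_sequence[OF core_dense[OF w]] by blast
  have L: "L2 I (v k)" for k using v(1) core_L2 by blast
  have Lw: "L2 I w" by (rule memL2_L2[OF w])
  have "(\<lambda>k. ipL2 I (v k) w) \<longlonglongrightarrow> ipL2 I w w"
    by (rule tendsto_ipL2[OF I L Lw v(2) Lw Lw]) (simp add: sqn_def)
  moreover have "ipL2 I (v k) w = 0" for k using v(1) orth by blast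
  ultimately have "ipL2 I w w = 0" by (simp add: LIMSEQ_const_iff)
  then show ?thesis by (simp add: sqn_eq_ipL2[OF I Lw])
qed

lemma closure_adjoint_exists:
  assumes uf: "(u, f) \<in> closureL2 H a b (pre_min J A a b)"
  shows "\<exists>g. memL2 H I g \<and> sqn I g = sqn I f \<and>
    (\<forall>(v, h)\<in>closureL2 H a b (pre_min J A a b). ipL2 I h u = ipL2 I v g)"
proof -
  have Lu: "L2 I u" and Lf: "L2 I f" using uf by (auto simp: closureL2_def intro: memL2_L2)
  obtain us fs where usfs: "\<And>k. (us k, fs k) \<in> pre_min J A a b"
    and us: "(\<lambda>k. sqn I (\<lambda>t. us k t - u t)) \<longlonglongrightarrow> 0" and fs: "(\<lambda>k. sqn I (\<lambda>t. fs k t - f t)) \<longlonglongrightarrow> 0"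
    using uf by (auto simp: closureL2_def)
  have "\<forall>k. \<exists>d e. core J A a b (us k) d e \<and> fs k = (\<lambda>t. d t + e t)"
    using pre_min_imp_core[OF usfs] by blast
  then obtain d e where de: "\<And>k. core J A a b (us k) (d k) (e k)" "\<And>k. fs k = (\<lambda>t. d k t + e k t)" by metis
  define gs where "gs k t = d k t - e k t" for k t
  note L = core_L2[OF de(1)]
  have Lus: "L2 I (us k)" for k using L by blast
  have Lfs: "L2 I (fs k)" for k unfolding de(2) using L by (intro L2_add[OF I]) auto
  have Lgs: "L2 I (gs k)" for k unfolding gs_def using L by (intro L2_diff[OF I]) auto
  have gsH: "memL2 H I (gs k)" for k
    using Lgs by (rule memL2_I) (use core_H[OF de(1)] H(1) in \<open>auto simp: gs_def intro: subspace_diff\<close>)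
  \<comment> \<open>The core is stable under subtraction, so the equality of norms applies to
    differences: the formal adjoint expressions are exactly as Cauchy as the values of
    \<open>l\<close>.\<close>
  have gs_fs: "sqn I (\<lambda>t. gs j t - gs k t) = sqn I (\<lambda>t. fs j t - fs k t)" for j k
    using core_norm[OF core_diff[OF de(1)[of j] de(1)[of k]]]
    by (simp add: gs_def de(2) algebra_simps)
  have "\<exists>N. \<forall>j\<ge>N. \<forall>k\<ge>N. sqn I (\<lambda>t. gs j t - gs k t) < ennreal r" if "r > 0" for r
  proof -
    have "eventually (\<lambda>k. sqn I (\<lambda>t. fs k t - f t) < ennreal (r / 4)) sequentially"
      by (rule order_tendstoD(2)[OF fs]) (use that in simp)
    then obtain N where N: "\<And>k. k \<ge> N \<Longrightarrow> sqn I (\<lambda>t. fs k t - f t) < ennreal (r / 4)"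
      unfolding eventually_sequentially by blast
    have "sqn I (\<lambda>t. gs j t - gs k t) < ennreal r" if jk: "j \<ge> N" "k \<ge> N" for j k
    proof -
      have "sqn I (\<lambda>t. fs j t - fs k t) \<le> 2 * sqn I (\<lambda>t. fs j t - f t) + 2 * sqn I (\<lambda>t. f t - fs k t)"
        by (intro sqn_triangle[OF I] L2_strongly_meas Lfs Lf)
      also have "\<dots> < ennreal r"
        using N[OF jk(1)] N[OF jk(2)] \<open>r > 0\<close>
        by (intro ennreal_two_halves_less) (auto simp: sqn_minus_commute[OF I, of f])
      finally show ?thesis unfolding gs_fs .
    qed
    then show ?thesis by blast
  qed
  from memL2_complete[OF I gsH H(2) subspace_0[OF H(1)] this]
  obtain g where g: "memL2 H I g" "(\<lambda>k. sqn I (\<lambda>t. gs k t - g t)) \<longlonglongrightarrow> 0" by blast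
  have Lg: "L2 I g" by (rule memL2_L2[OF g(1)])
  have "(\<lambda>k. sqn I (gs k)) \<longlonglongrightarrow> sqn I g" by (rule tendsto_sqn[OF I Lgs Lg g(2)])
  moreover have "sqn I (gs k) = sqn I (fs k)" for k
    unfolding gs_def[abs_def] de(2) by (rule core_norm[OF de(1)])
  then have "(\<lambda>k. sqn I (gs k)) \<longlonglongrightarrow> sqn I f"
    using tendsto_sqn[OF I Lfs Lf fs] by simp
  ultimately have "sqn I g = sqn I f" by (rule LIMSEQ_unique)
  moreover have "ipL2 I h u = ipL2 I v g" if vh: "(v, h) \<in> closureL2 H a b (pre_min J A a b)" for v h
  proof -
    have Lv: "L2 I v" and Lh: "L2 I h" using vh by (auto simp: closureL2_def intro: memL2_L2)
    obtain vs hs where vshs: "\<And>k. (vs k, hs k) \<in> pre_min J A a b"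
      and vs: "(\<lambda>k. sqn I (\<lambda>t. vs k t - v t)) \<longlonglongrightarrow> 0" and hs: "(\<lambda>k. sqn I (\<lambda>t. hs k t - h t)) \<longlonglongrightarrow> 0"
      using vh by (auto simp: closureL2_def)
    have "\<forall>k. \<exists>d e. core J A a b (vs k) d e \<and> hs k = (\<lambda>t. d t + e t)"
      using pre_min_imp_core[OF vshs] by blast
    then obtain d' e' where de': "\<And>k. core J A a b (vs k) (d' k) (e' k)" "\<And>k. hs k = (\<lambda>t. d' k t + e' k t)" by metis
    note L' = core_L2[OF de'(1)]
    have Lvs: "L2 I (vs k)" for k using L' by blast
    have Lhs: "L2 I (hs k)" for k unfolding de'(2) using L' by (intro L2_add[OF I]) auto
    have hu: "(\<lambda>k. ipL2 I (hs k) (us k)) \<longlonglongrightarrow> ipL2 I h u" by (rule tendsto_ipL2[OF I Lhs Lh hs Lus Lu us])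
    have vg: "(\<lambda>k. ipL2 I (vs k) (gs k)) \<longlonglongrightarrow> ipL2 I v g" by (rule tendsto_ipL2[OF I Lvs Lv vs Lgs Lg g(2)])
    \<comment> \<open>\<open>core_adjoint\<close> speaks about core functions only, so both pairs
      are replaced by their approximating sequences with the same index before the limit is
      taken.\<close>
    have "ipL2 I (hs k) (us k) = ipL2 I (vs k) (gs k)" for k
      unfolding gs_def[abs_def] de'(2) by (rule core_adjoint[OF de'(1) de(1)])
    then show ?thesis using LIMSEQ_unique[OF hu] vg by simp
  qed
  ultimately show ?thesis using g(1) by blast
qed

lemma pre_min_closure:
  assumes "(u, f) \<in> pre_min J A a b" shows "(u, f) \<in> closureL2 H a b (pre_min J A a b)"
proof -
  obtain d e where de: "core J A a b u d e" "f = (\<lambda>t. d t + e t)" using pre_min_imp_core[OF assms] by blast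
  note L = core_L2[OF de(1)] and m = core_H[OF de(1)]
  have "memL2 H I u" using L m by (intro memL2_I) auto
  moreover have "memL2 H I f" unfolding de(2) using L m by (intro memL2_I L2_add[OF I]) (auto intro: subspace_add H)
  moreover have "\<exists>us fs. (\<forall>k. (us k, fs k) \<in> pre_min J A a b)
      \<and> (\<lambda>k. sqn I (\<lambda>t. us k t - u t)) \<longlonglongrightarrow> 0 \<and> (\<lambda>k. sqn I (\<lambda>t. fs k t - f t)) \<longlonglongrightarrow> 0"
    by (rule exI[of _ "\<lambda>k. u"], rule exI[of _ "\<lambda>k. f"]) (simp add: assms sqn_def)
  ultimately show ?thesis by (simp add: closureL2_def)
qed

end

section \<open>The direct sum\<close>


lemma ennreal_suminf_tail:
  fixes f :: "nat \<Rightarrow> ennreal"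
  assumes fin: "(\<Sum>i. f i) < \<infinity>" and e: "e > 0"
  shows "\<exists>N. (\<Sum>i. f (i + N)) < ennreal e"
proof -
  have f: "f i < \<infinity>" for i by (rule ennreal_suminf_lessD[OF fin])
  define g where "g i = enn2real (f i)" for i
  have fg: "f i = ennreal (g i)" for i using f[of i] by (simp add: g_def)
  have g0: "0 \<le> g i" for i by (simp add: g_def)
  have sg: "summable g"
    by (rule summable_suminf_not_top) (use fin in \<open>simp_all add: fg[symmetric] g0\<close>)
  obtain N where N: "norm (\<Sum>i. g (i + N)) < e"
    using suminf_exist_split[OF e sg] by blast
  have "(\<Sum>i. f (i + N)) = ennreal (\<Sum>i. g (i + N))"
    unfolding fg by (rule suminf_ennreal2) (use summable_ignore_initial_segment[OF sg] g0 in auto)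
  also have "\<dots> < ennreal e" using N e by (intro ennreal_lessI) auto
  finally show ?thesis by blast
qed

text \<open>Supplies the elements of \<open>L0\<close> that live on finitely many intervals: an
  initial segment of them for density, a single one for testing the adjoint.\<close>

lemma L0_finite:
  assumes op: "\<And>n. min_op J (Hs n) (A n) (a n) (b n)"
    and vh: "\<And>n. n \<in> K \<Longrightarrow> (v n, h n) \<in> pre_min J (A n) (a n) (b n)" and K: "finite K"
  shows "(\<lambda>n. if n \<in> K then v n else (\<lambda>t. 0), \<lambda>n. if n \<in> K then h n else (\<lambda>t. 0)) \<in> L0 J Hs A a b"
    (is "(?V, ?F) \<in> _")
proof -
  have zero: "(\<lambda>t. 0, \<lambda>t. 0) \<in> pre_min J (A n) (a n) (b n)" for n
    using core_imp_pre_min[OF core.zero] by simp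
  have cl: "(?V n, ?F n) \<in> closureL2 (Hs n) (a n) (b n) (pre_min J (A n) (a n) (b n))" for n
    by (rule min_op.pre_min_closure[OF op]) (use vh zero in auto)
  then have m: "memL2 (Hs n) {a n<..<b n} (?V n)" "memL2 (Hs n) {a n<..<b n} (?F n)" for n
    by (auto simp only: closureL2_def mem_Collect_eq split: prod.splits)
  have fin: "sqnS a b (\<lambda>n. if n \<in> K then w n else (\<lambda>t. 0)) < \<infinity>"
    if "\<And>n. sqn {a n<..<b n} (if n \<in> K then w n else (\<lambda>t. 0)) < \<infinity>" for w :: "nat \<Rightarrow> real \<Rightarrow> 'a"
  proof -
    have "sqnS a b (\<lambda>n. if n \<in> K then w n else (\<lambda>t. 0)) =
        (\<Sum>n\<in>K. sqn {a n<..<b n} (if n \<in> K then w n else (\<lambda>t. 0)))"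
      unfolding sqnS_def by (rule suminf_finite[OF K]) (simp add: sqn_def)
    also have "\<dots> < \<infinity>"
      unfolding infinity_ennreal_def ennreal_sum_less_top[OF K]
      using that[unfolded infinity_ennreal_def] by blast
    finally show ?thesis .
  qed
  have "sqnS a b ?V < \<infinity>" "sqnS a b ?F < \<infinity>"
    by (rule fin, use m in \<open>simp only: memL2_def\<close>)+
  then show ?thesis unfolding L0_def memL2S_def using m cl by simp
qed

lemma L0_dense:
  assumes op: "\<And>n. min_op J (Hs n) (A n) (a n) (b n)" and u: "memL2S Hs a b u" and e: "\<epsilon> > 0"
  shows "\<exists>(v, f)\<in>L0 J Hs A a b. sqnS a b (\<lambda>n t. u n t - v n t) < ennreal \<epsilon>"
proof -
  let ?I = "\<lambda>n. {a n<..<b n}"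
  have "(\<Sum>n. sqn (?I n) (u n)) < \<infinity>" using u by (simp add: memL2S_def sqnS_def)
  then obtain N where N: "(\<Sum>n. sqn (?I (n + N)) (u (n + N))) < ennreal (\<epsilon> / 2)"
    using ennreal_suminf_tail[of "\<lambda>n. sqn (?I n) (u n)" "\<epsilon> / 2"] e by auto
  \<comment> \<open>The \<open>N\<close> approximated components together may cost
    \<open>\<epsilon> / 2\<close>, the tail having used the other half; \<open>Suc\<close> covers
    \<open>N = 0\<close>.\<close>
  define r where "r = \<epsilon> / (2 * real (Suc N))"
  have r: "r > 0" "real N * r \<le> \<epsilon> / 2" using e by (auto simp: r_def field_simps)
  have "\<exists>v h. (v, h) \<in> pre_min J (A n) (a n) (b n) \<and> sqn (?I n) (\<lambda>t. v t - u n t) < ennreal r" for n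
  proof -
    have "memL2 (Hs n) (?I n) (u n)" using u by (simp add: memL2S_def)
    from min_op.core_dense[OF op this] r(1)
    obtain v d e where "core J (A n) (a n) (b n) v d e" "sqn (?I n) (\<lambda>t. v t - u n t) < ennreal r"
      unfolding approximable_def by blast
    then show ?thesis using core_imp_pre_min by blast
  qed
  then obtain v h where vh: "\<And>n. (v n, h n) \<in> pre_min J (A n) (a n) (b n)"
    "\<And>n. sqn (?I n) (\<lambda>t. v n t - u n t) < ennreal r" by metis
  let ?V = "\<lambda>n. if n \<in> {..<N} then v n else (\<lambda>t. 0)" and ?F = "\<lambda>n. if n \<in> {..<N} then h n else (\<lambda>t. 0)"
  have T: "(?V, ?F) \<in> L0 J Hs A a b" by (rule L0_finite[OF op vh(1)]) simp
  let ?s = "\<lambda>n. sqn (?I n) (\<lambda>t. u n t - ?V n t)"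
  have "sqnS a b (\<lambda>n t. u n t - ?V n t) = (\<Sum>n. ?s n)" by (simp only: sqnS_def)
  also have "\<dots> = (\<Sum>n. ?s (n + N)) + (\<Sum>n<N. ?s n)" by (rule suminf_offset) (rule summableI)
  also have "(\<Sum>n. ?s (n + N)) = (\<Sum>n. sqn (?I (n + N)) (u (n + N)))" by simp
  also have "(\<Sum>n<N. ?s n) \<le> (\<Sum>n<N. ennreal r)"
  proof (rule sum_mono)
    fix n assume "n \<in> {..<N}"
    then have "?s n = sqn (?I n) (\<lambda>t. v n t - u n t)" by (simp add: sqn_minus_commute[OF Ioo_lebesgue, of _ _ "u n"])
    then show "?s n \<le> ennreal r" using vh(2)[of n] by simp
  qed
  also have "(\<Sum>n<N. ennreal r) = ennreal (real N * r)" using r(1) by (simp add: ennreal_mult ennreal_of_nat_eq_real_of_nat)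
  also have "\<dots> \<le> ennreal (\<epsilon> / 2)" by (rule ennreal_leI[OF r(2)])
  finally have "sqnS a b (\<lambda>n t. u n t - ?V n t) \<le> (\<Sum>n. sqn (?I (n + N)) (u (n + N))) + ennreal (\<epsilon> / 2)"
    by (simp add: add_left_mono)
  also have "\<dots> < ennreal (\<epsilon> / 2) + ennreal (\<epsilon> / 2)"
    using N by (simp add: ennreal_add_left_cancel_less add.commute)
  also have "\<dots> = ennreal \<epsilon>" using e by (simp add: ennreal_plus[symmetric] del: ennreal_plus)
  finally show ?thesis using T by (intro bexI[of _ "(?V, ?F)"]) (simp_all only: prod.case)
qed

lemma L0_adjoint_exists:
  assumes op: "\<And>n. min_op J (Hs n) (A n) (a n) (b n)" and uf: "(u, f) \<in> L0 J Hs A a b"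
  shows "\<exists>g. (u, g) \<in> adjL2S Hs a b (L0 J Hs A a b) \<and> sqnS a b g = sqnS a b f"
proof -
  let ?I = "\<lambda>n. {a n<..<b n}"
  let ?C = "\<lambda>n. closureL2 (Hs n) (a n) (b n) (pre_min J (A n) (a n) (b n))"
  have mem: "memL2S Hs a b u" "memL2S Hs a b f" and "(u n, f n) \<in> ?C n" for n
    using uf by (auto simp: L0_def)
  then have "\<forall>n. \<exists>g. memL2 (Hs n) (?I n) g \<and> sqn (?I n) g = sqn (?I n) (f n) \<and>
      (\<forall>(v, h)\<in>?C n. ipL2 (?I n) h (u n) = ipL2 (?I n) v g)"
    using min_op.closure_adjoint_exists[OF op] by blast
  then obtain g where g: "\<And>n. memL2 (Hs n) (?I n) (g n)" "\<And>n. sqn (?I n) (g n) = sqn (?I n) (f n)"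
    "\<And>n. \<forall>(v, h)\<in>?C n. ipL2 (?I n) h (u n) = ipL2 (?I n) v (g n)" by metis
  \<comment> \<open>Equality of norms in every component is also what makes the separately chosen
    \<open>g n\<close> square summable.\<close>
  have norm: "sqnS a b g = sqnS a b f" by (simp add: sqnS_def g(2))
  have "memL2S Hs a b g" using mem(2) g(1) by (simp add: memL2S_def norm)
  moreover have "ipL2S a b h u = ipL2S a b v g" if "(v, h) \<in> L0 J Hs A a b" for v h
  proof -
    have "ipL2 (?I n) (h n) (u n) = ipL2 (?I n) (v n) (g n)" for n
      using that g(3)[of n] by (auto simp: L0_def)
    then show ?thesis by (simp add: ipL2S_def)
  qed
  ultimately show ?thesis using mem(1) norm by (auto simp: adjL2S_def)
qed

text \<open>Testing against an element of \<open>L0\<close> whose only nonzero component is the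
  \<open>n\<close>-th collapses both series to one term.\<close>

lemma adjoint_L0_core:
  assumes op: "\<And>n. min_op J (Hs n) (A n) (a n) (b n)"
    and ug: "(u, g) \<in> adjL2S Hs a b (L0 J Hs A a b)" and c: "core J (A n) (a n) (b n) v d e"
  shows "ipL2 {a n<..<b n} (\<lambda>t. d t + e t) (u n) = ipL2 {a n<..<b n} v (g n)"
proof -
  let ?S = "\<lambda>w m. if m \<in> {n} then w else (\<lambda>t. 0)"
  have single: "ipL2S a b (?S w) z = ipL2 {a n<..<b n} w (z n)" for w z
  proof -
    have "ipL2S a b (?S w) z = (\<Sum>m\<in>{n}. ipL2 {a m<..<b m} (?S w m) (z m))"
      unfolding ipL2S_def by (rule suminf_finite) (simp_all add: ipL2_zero_left[OF Ioo_lebesgue])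
    then show ?thesis by simp
  qed
  have "(?S v, ?S (\<lambda>t. d t + e t)) \<in> L0 J Hs A a b"
    by (rule L0_finite[OF op, where v="\<lambda>_. v" and h="\<lambda>_ t. d t + e t"])
       (use core_imp_pre_min[OF c] in auto)
  then have "ipL2S a b (?S (\<lambda>t. d t + e t)) u = ipL2S a b (?S v) g"
    using ug by (auto simp: adjL2S_def)
  then show ?thesis by (simp only: single)
qed

text \<open>On each interval the difference of two adjoint values is orthogonal to the core, which
  is dense, so it has norm 0. The values themselves may differ on null sets, hence the conclusion
  about norms.\<close>

lemma adjoint_L0_sqnS_unique:
  assumes op: "\<And>n. min_op J (Hs n) (A n) (a n) (b n)"
    and g: "(u, g) \<in> adjL2S Hs a b (L0 J Hs A a b)" and g': "(u, g') \<in> adjL2S Hs a b (L0 J Hs A a b)"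
  shows "sqnS a b g = sqnS a b g'"
proof -
  have "sqn {a n<..<b n} (g n) = sqn {a n<..<b n} (g' n)" for n
  proof -
    let ?I = "{a n<..<b n}"
    note I = Ioo_lebesgue[of "a n" "b n"]
    have m: "memL2 (Hs n) ?I (g n)" "memL2 (Hs n) ?I (g' n)"
      using g g' by (auto simp: adjL2S_def memL2S_def)
    note L = m[THEN min_op.memL2_L2[OF op]]
    have "ipL2 ?I v (\<lambda>t. g n t - g' n t) = 0" if c: "core J (A n) (a n) (b n) v d e" for v d e
      using adjoint_L0_core[OF op g c] adjoint_L0_core[OF op g' c] min_op.core_L2[OF op c] L
      by (simp add: ipL2_diff_right[OF I])
    then have z: "sqn ?I (\<lambda>t. g n t - g' n t) = 0"
      by (rule min_op.core_orthogonal_zero[OF op min_op.memL2_diff[OF op m]])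
    \<comment> \<open>A constant sequence at distance 0 from \<open>g' n\<close> converges to it, so
      continuity of \<open>sqn\<close> gives equal norms.\<close>
    have "(\<lambda>k::nat. sqn ?I (g n)) \<longlonglongrightarrow> sqn ?I (g' n)"
      by (rule tendsto_sqn[OF I L]) (simp add: z)
    then show ?thesis by (simp add: LIMSEQ_const_iff)
  qed
  then show ?thesis by (simp add: sqnS_def)
qed

theorem theorem2p6:
  fixes J :: "'h::{real_inner,complete_space} \<Rightarrow> 'h"
    and Hs :: "nat \<Rightarrow> 'h set"
    and A :: "nat \<Rightarrow> ('h \<times> 'h) set"
    and a b :: "nat \<Rightarrow> real"
  assumes "cstruct J"
    and "\<And>n. a n < b n"
    and "\<And>n. b n \<le> a (Suc n)"
    and "\<And>n. csubspace J (Hs n)"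
    and "\<And>n. selfadjoint_op J (Hs n) (A n)"
    and "\<And>n. posdef_op (A n)"
    and "\<forall>u. memW22S Hs a b u \<longrightarrow>
           (\<exists>v. memW22S Hs a b v \<and>
              (\<forall>n. AE t in lebesgue. t \<in> {a n<..<b n} \<longrightarrow> (u n t, v n t) \<in> sqrt_op J (Hs n) (A n)))"
  shows "formally_normal Hs a b (L0 J Hs A a b)"
proof -
  have op: "min_op J (Hs n) (A n) (a n) (b n)" for n
    using assms(1,2,4,5) by unfold_locales
  show ?thesis
    unfolding formally_normal_def
  proof (intro conjI allI impI ballI)
    show "\<exists>(v, f)\<in>L0 J Hs A a b. sqnS a b (\<lambda>n t. u n t - v n t) < ennreal \<epsilon>"
      if "memL2S Hs a b u" "\<epsilon> > 0" for u \<epsilon>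
      by (rule L0_dense[OF op that])
  next
    fix p assume "p \<in> L0 J Hs A a b"
    then obtain u f where p: "p = (u, f)" and uf: "(u, f) \<in> L0 J Hs A a b" by (cases p) auto
    obtain g where g: "(u, g) \<in> adjL2S Hs a b (L0 J Hs A a b)" "sqnS a b g = sqnS a b f"
      using L0_adjoint_exists[OF op uf] by blast
    show "case p of (u, f) \<Rightarrow> \<exists>g. (u, g) \<in> adjL2S Hs a b (L0 J Hs A a b)"
      using g(1) p by auto
    show "case p of (u, f) \<Rightarrow> \<forall>g. (u, g) \<in> adjL2S Hs a b (L0 J Hs A a b) \<longrightarrow> sqnS a b f = sqnS a b g"
      using adjoint_L0_sqnS_unique[OF op g(1)] g(2) p by auto
  qed
qed

end
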